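(* Let $\mathsf X$ and $\mathsf Y$ be Polish spaces with their Borel $\sigma$-algebras, let $\mathcal A$ be a space of functions on $\mathsf Y$ and $\Gamma:\mathcal A\times\mathcal A\to\mathcal A$ a gradient-type operator as in the context, let $P$ be a Markov kernel from $\mathsf X$ to $\mathsf Y$ (with $P_x := P(x,\cdot)$), and let $\mu$ be a probability measure on $\mathsf X$. Let $K_{\rm P}=K_{\rm P}(P;\mu)$, $K_{\rm LS}=K_{\rm LS}(P;\mu)$ and $K_{p,\chi^2}=K_{p,\chi^2}(P;\mu)$ be as defined in the context, and for $p>1$ let $p^*=\frac{p}{p-1}$. (1) If $K_{\rm P}$ and $K_{p,\chi^2}$ are finite for some $p\in(1,\infty)$, then the mixture $\mu P$ satisfies a Poincaré inequality with constant $$C_{\rm P}(\mu P)\le K_{\rm P}\,\bigl\{p^*+K_{p,\chi^2}^{\,p^*}\bigr\}.$$ (2) If $K_{\rm LS}$ and $K_{p,\chi^2}$ are finite for some $p\in(1,\infty)$, then the mixture $\mu P$ satisfies a log-Sobolev inequality with constant $$C_{\rm LS}(\mu P)\le 3K_{\rm LS}\,\bigl(p^*+K_{p,\chi^2}^{\,p^*}\bigr)\,\bigl(1+\log K_{p,\chi^2}^{\,p^*}\bigr).$$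
   Context: $\mathcal A$ is a vector space of bounded measurable real functions on $\mathsf Y$ containing all constant functions. $\Gamma:\mathcal A\times\mathcal A\to\mathcal A$ is a symmetric bilinear operator with $\Gamma(f,f)\ge 0$ everywhere on $\mathsf Y$ for every $f\in\mathcal A$, and $\Gamma(1,1)=0$. Write $\Gamma(f)=\Gamma(f,f)$. For a probability measure $\rho$ on $\mathsf Y$: $\mathbb E_\rho f=\int f\,d\rho$, $\operatorname{var}_\rho(f)=\mathbb E_\rho[(f-\mathbb E_\rho f)^2]$, and, for $g\ge 0$, $\operatorname{ent}_\rho(g)=\mathbb E_\rho(g\log g)-\mathbb E_\rho g\,\log\mathbb E_\rho g$ (with $0\log 0=0$). $\rho$ satisfies a Poincaré inequality if there is a constant $C$ with $\operatorname{var}_\rho(f)\le C\,\mathbb E_\rho\Gamma(f)$ for all $f\in\mathcal A$; the optimal (smallest) constant is $C_{\rm P}(\rho)$. $\rho$ satisfies a log-Sobolev inequality if there is a constant $C$ with $\operatorname{ent}_\rho(f^2)\le 2C\,\mathbb E_\rho\Gamma(f)$ for all $f\in\mathcal A$; the optimal constant is $C_{\rm LS}(\rho)$. These constants are $+\infty$ if no such $C$ exists. $\chi^2(\rho_1\|\rho_2)=\int\bigl(\frac{d\rho_1}{d\rho_2}-1\bigr)^2d\rho_2$ if $\rho_1\ll\rho_2$, and $+\infty$ otherwise. A Markov kernel $P$ from $\mathsf X$ to $\mathsf Y$: each $P_x=P(x,\cdot)$ is a Borel probability measure on $\mathsf Y$, and $x\mapsto P(x,B)$ is measurable for each Borel $B\subseteq\mathsf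 Y$. The mixture $\mu P$ is the probability measure on $\mathsf Y$ given by $\mu P(B)=\int_{\mathsf X}P_x(B)\,d\mu(x)$. $K_{\rm P}(P;\mu)$ is the $\mu$-essential supremum over $x\in\mathsf X$ of $C_{\rm P}(P_x)$; $K_{\rm LS}(P;\mu)$ is the $\mu$-essential supremum of $C_{\rm LS}(P_x)$; that is, each is the smallest $c\in[0,\infty]$ such that the constant of $P_x$ is at most $c$ for $\mu$-a.e. $x$. For $p\ge1$, $$K_{p,\chi^2}(P;\mu)=\mathbb E\bigl[\bigl(1+\chi^2(P_X\|P_{X'})\bigr)^p\bigr]^{1/p},$$ where $X,X'$ are i.i.d. with law $\mu$. *)

theory Defs
  imports "HOL-Probability.Probability"
begin

(* The carrier is a set of functions, so A is required to be a linear subspace explicitly;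
   the axioms on \<Gamma> concern its values on A only. *)
locale gradient_form =
  fixes A :: "('y::topological_space \<Rightarrow> real) set"
    and \<Gamma> :: "('y \<Rightarrow> real) \<Rightarrow> ('y \<Rightarrow> real) \<Rightarrow> 'y \<Rightarrow> real"
  assumes measurable: "f \<in> A \<Longrightarrow> f \<in> borel_measurable borel"
    and bounded: "f \<in> A \<Longrightarrow> bounded (range f)"
    and const: "(\<lambda>_. c) \<in> A"
    and add: "f \<in> A \<Longrightarrow> g \<in> A \<Longrightarrow> (\<lambda>y. f y + g y) \<in> A"
    and scale: "f \<in> A \<Longrightarrow> (\<lambda>y. c * f y) \<in> A"
    and \<Gamma>_closed: "f \<in> A \<Longrightarrow> g \<in> A \<Longrightarrow> \<Gamma> f g \<in> A"
    and \<Gamma>_sym: "f \<in> A \<Longrightarrow> g \<in> A \<Longrightarrow> \<Gamma> f g = \<Gamma> g f"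
    and \<Gamma>_add: "f \<in> A \<Longrightarrow> g \<in> A \<Longrightarrow> h \<in> A \<Longrightarrow>
      \<Gamma> (\<lambda>y. f y + g y) h = (\<lambda>y. \<Gamma> f h y + \<Gamma> g h y)"
    and \<Gamma>_scale: "f \<in> A \<Longrightarrow> h \<in> A \<Longrightarrow> \<Gamma> (\<lambda>y. c * f y) h = (\<lambda>y. c * \<Gamma> f h y)"
    and \<Gamma>_nonneg: "f \<in> A \<Longrightarrow> 0 \<le> \<Gamma> f f y"
    and \<Gamma>_one: "\<Gamma> (\<lambda>_. 1) (\<lambda>_. 1) = (\<lambda>_. 0)"

(* The convention 0 log 0 = 0 holds automatically. *)
definition ent :: "'y measure \<Rightarrow> ('y \<Rightarrow> real) \<Rightarrow> real" where
  "ent \<rho> g = (\<integral>y. g y * ln (g y) \<partial>\<rho>) - (\<integral>y. g y \<partial>\<rho>) * ln (\<integral>y. g y \<partial>\<rho>)"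

definition poincare_ineq ::
  "('y \<Rightarrow> real) set \<Rightarrow> (('y \<Rightarrow> real) \<Rightarrow> ('y \<Rightarrow> real) \<Rightarrow> 'y \<Rightarrow> real) \<Rightarrow> 'y measure \<Rightarrow> real \<Rightarrow> bool" where
  "poincare_ineq A \<Gamma> \<rho> C \<longleftrightarrow> (\<forall>f\<in>A. prob_space.variance \<rho> f \<le> C * (\<integral>y. \<Gamma> f f y \<partial>\<rho>))"

definition log_sobolev_ineq ::
  "('y \<Rightarrow> real) set \<Rightarrow> (('y \<Rightarrow> real) \<Rightarrow> ('y \<Rightarrow> real) \<Rightarrow> 'y \<Rightarrow> real) \<Rightarrow> 'y measure \<Rightarrow> real \<Rightarrow> bool" where
  "log_sobolev_ineq A \<Gamma> \<rho> C \<longleftrightarrow>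
     (\<forall>f\<in>A. ent \<rho> (\<lambda>y. (f y)\<^sup>2) \<le> 2 * C * (\<integral>y. \<Gamma> f f y \<partial>\<rho>))"

(* Optimal constants range over [0, \<infinity>]; the infimum of the empty set is \<infinity>.
   Without the sign condition the infimum could be taken over negative C
   when both sides of the inequality vanish identically. *)
definition poincare_const ::
  "('y \<Rightarrow> real) set \<Rightarrow> (('y \<Rightarrow> real) \<Rightarrow> ('y \<Rightarrow> real) \<Rightarrow> 'y \<Rightarrow> real) \<Rightarrow> 'y measure \<Rightarrow> ennreal" where
  "poincare_const A \<Gamma> \<rho> = Inf {ennreal C | C. 0 \<le> C \<and> poincare_ineq A \<Gamma> \<rho> C}"

definition log_sobolev_const ::
  "('y \<Rightarrow> real) set \<Rightarrow> (('y \<Rightarrow> real) \<Rightarrow> ('y \<Rightarrow> real) \<Rightarrow> 'y \<Rightarrow> real) \<Rightarrow> 'y measure \<Rightarrow> ennreal" where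
  "log_sobolev_const A \<Gamma> \<rho> = Inf {ennreal C | C. 0 \<le> C \<and> log_sobolev_ineq A \<Gamma> \<rho> C}"

(* The library's esssup returns \<infinity> on non-measurable functions; here measurability of
   the optimal constants of P x in x is not presupposed. *)
definition ess_bound :: "'x measure \<Rightarrow> ('x \<Rightarrow> ennreal) \<Rightarrow> ennreal" where
  "ess_bound \<mu> g = Inf {c. AE x in \<mu>. g x \<le> c}"

definition K_P ::
  "('y \<Rightarrow> real) set \<Rightarrow> (('y \<Rightarrow> real) \<Rightarrow> ('y \<Rightarrow> real) \<Rightarrow> 'y \<Rightarrow> real) \<Rightarrow>
   ('x \<Rightarrow> 'y measure) \<Rightarrow> 'x measure \<Rightarrow> ennreal" where
  "K_P A \<Gamma> P \<mu> = ess_bound \<mu> (\<lambda>x. poincare_const A \<Gamma> (P x))"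

definition K_LS ::
  "('y \<Rightarrow> real) set \<Rightarrow> (('y \<Rightarrow> real) \<Rightarrow> ('y \<Rightarrow> real) \<Rightarrow> 'y \<Rightarrow> real) \<Rightarrow>
   ('x \<Rightarrow> 'y measure) \<Rightarrow> 'x measure \<Rightarrow> ennreal" where
  "K_LS A \<Gamma> P \<mu> = ess_bound \<mu> (\<lambda>x. log_sobolev_const A \<Gamma> (P x))"

(* absolutely_continuous \<rho>2 \<rho>1 means \<rho>1 \<lless> \<rho>2, and RN_deriv \<rho>2 \<rho>1 is d\<rho>1/d\<rho>2,
   which is finite almost everywhere for probability measures. *)
definition chi2 :: "'y measure \<Rightarrow> 'y measure \<Rightarrow> ennreal" where
  "chi2 \<rho>1 \<rho>2 =
     (if absolutely_continuous \<rho>2 \<rho>1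
      then \<integral>\<^sup>+ y. ennreal ((enn2real (RN_deriv \<rho>2 \<rho>1 y) - 1)\<^sup>2) \<partial>\<rho>2
      else \<infinity>)"

(* Powers on [0, \<infinity>], used for positive exponents only. *)
definition ennpowr :: "ennreal \<Rightarrow> real \<Rightarrow> ennreal" where
  "ennpowr x p = (if x = \<infinity> then \<infinity> else ennreal (enn2real x powr p))"

definition K_chi2 :: "real \<Rightarrow> ('x \<Rightarrow> 'y measure) \<Rightarrow> 'x measure \<Rightarrow> ennreal" where
  "K_chi2 p P \<mu> =
     ennpowr (\<integral>\<^sup>+ (x, x'). ennpowr (1 + chi2 (P x) (P x')) p \<partial>(\<mu> \<Otimes>\<^sub>M \<mu>)) (1 / p)"

lemma one_le_ennpowr:
  assumes "1 \<le> x" "0 < p"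
  shows "1 \<le> ennpowr x p"
proof (cases x)
  case (real r)
  with assms have "1 \<le> r"
    by (metis ennreal_1 ennreal_le_iff)
  with real assms show ?thesis
    by (simp add: ennpowr_def ge_one_powr_ge_zero)
qed (simp add: ennpowr_def)

(* Hence the logarithms of finite powers of K_chi2 are nonnegative,
   so that converting them to ennreal does not truncate. *)
lemma one_le_K_chi2:
  assumes "prob_space \<mu>" "0 < p"
  shows "1 \<le> K_chi2 p P \<mu>"
proof -
  interpret pair_prob_space \<mu> \<mu>
    using assms by (simp add: pair_prob_space_def pair_sigma_finite_def prob_space_imp_sigma_finite)
  have "(1::ennreal) = (\<integral>\<^sup>+ z. 1 \<partial>(\<mu> \<Otimes>\<^sub>M \<mu>))"
    by (simp add: emeasure_space_1)
  also have "\<dots> \<le> (\<integral>\<^sup>+ (x, x'). ennpowr (1 + chi2 (P x) (P x')) p \<partial>(\<mu> \<Otimes>\<^sub>M \<mu>))"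
    using assms by (intro nn_integral_mono) (auto intro!: one_le_ennpowr)
  finally show ?thesis
    unfolding K_chi2_def using assms by (intro one_le_ennpowr) auto
qed

end

theory Submission
  imports Defs
begin

text \<open>
  Write \<open>G x\<close> for the mean of \<open>f\<close> under \<open>P x\<close>. The variance of \<open>f\<close> under the mixture is the
  \<open>\<mu>\<close>-mean of the variances under \<open>P x\<close>, which the component inequalities control, plus the variance
  of \<open>G\<close>. A shift of the mean of \<open>f\<close> between \<open>P x\<close> and \<open>P x'\<close> costs chi-squared divergence:
  \<open>(G x - G x')\<^sup>2 \<le> Var x' * chi2 x x'\<close>. Averaging this bound in its linearised form, with a multiplier
  proportional to \<open>G x - mean\<close>, decouples the two coordinates, so that \<open>Var x'\<close> appears only through its
  mean, which the energy of \<open>f\<close> controls. The outcome (\<open>mixture_variance_le\<close>) is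
  the bound \<open>K_P * E (1 + chi2)\<close> on the Poincare constant, and \<open>E (1 + chi2) \<le> K_chi2\<close>.

  The entropy of \<open>F = f\<^sup>2\<close> splits in the same way. With \<open>g x\<close> the mean of \<open>F\<close> under \<open>P x\<close>, tilting
  \<open>P x\<close> by \<open>F\<close> and comparing with \<open>P x'\<close> gives
  \<open>g x * ln (g x / g x') \<le> ent (P x) F + g x * ln (1 + chi2 x x')\<close> (\<open>chi2_entropic\<close>). The average of the last
  term is at most \<open>1 / p\<close> times the entropy of \<open>g\<close> plus \<open>E g * ln K_chi2\<close>, by the variational formula for
  entropy applied to \<open>(1 + chi2) ^ p\<close>. As \<open>1 / p < 1\<close>, the entropy of \<open>g\<close> is absorbed into the left-hand
  side at the price of the factor \<open>p / (p - 1)\<close>; this is a defective log-Sobolev inequality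
  (\<open>mixture_ent_le\<close>), with an extra term proportional to the mean of \<open>f\<^sup>2\<close>. A log-Sobolev inequality
  implies a Poincare inequality with the same constant (\<open>log_sobolev_imp_poincare\<close>), so the mixture has
  one as well, and an estimate of Rothaus type (\<open>ent_shift_le\<close>) removes the defect by
  recentring \<open>f\<close>.

  The divergence \<open>chi2 (P x) (P x')\<close> enters only through lower bounds by explicit bounded functions
  of \<open>(x, x')\<close>. They are built from integrals against the kernel and are therefore jointly measurable,
  so that Fubini's theorem applies to them, and the integral in \<open>K_chi2\<close> dominates theirs by
  monotonicity (\<open>K_chi2_minorant\<close>).
\<close>

section \<open>Inequalities for the logarithm\<close>

lemma ln_le_tangent:
  fixes a b :: real
  assumes "0 < a" "0 < b"
  shows "ln a \<le> ln b + a / b - 1"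
  using ln_le_minus_one[of "a / b"] assms by (simp add: ln_div)

text \<open>
  The left-hand side is \<open>2 * (1 + u)\<^sup>2 * ln (1 + u)\<close>; the derivative of the difference from its
  second-order Taylor polynomial is \<open>4 * ((1 + u) * ln (1 + u) - u)\<close>, which lies between \<open>0\<close> and \<open>4 * u\<^sup>2\<close>.
  The error is of third order, as required to recover the variance as the second-order term of the
  entropy.
\<close>
lemma mult_ln_lower_cubic:
  fixes u :: real
  assumes "-1 < u"
  shows "(1 + u)\<^sup>2 * ln ((1 + u)\<^sup>2) \<ge> 2 * u + 3 * u\<^sup>2 - 2 * \<bar>u\<bar> ^ 3"
proof -
  define q where "q = (\<lambda>u::real. 2 * (1 + u)\<^sup>2 * ln (1 + u) - 2 * u - 3 * u\<^sup>2)"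
  have dq: "(q has_real_derivative 4 * ((1 + x) * ln (1 + x) - x)) (at x)" if "-1 < x" for x
  proof -
    have "(q has_real_derivative 4 * (1 + x) * ln (1 + x) + 2 * (1 + x)\<^sup>2 * (1 / (1 + x)) - 2 - 6 * x) (at x)"
      unfolding q_def using that by (auto intro!: derivative_eq_intros)
    moreover have "2 * (1 + x)\<^sup>2 * (1 / (1 + x)) = 2 + 2 * x"
      using that by (simp add: power2_eq_square)
    ultimately show ?thesis by (simp add: algebra_simps)
  qed
  have "q u \<ge> - 2 * \<bar>u\<bar> ^ 3"
  proof (cases "0 \<le> u")
    case True
    have "q 0 \<le> q u"
    proof (rule DERIV_nonneg_imp_nondecreasing[OF True])
      fix x :: real assume x: "0 \<le> x" "x \<le> u"
      have "x / (1 + x) \<le> ln (1 + x)"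
        using ln_le_minus_one[of "1 / (1 + x)"] x by (simp add: ln_div field_simps)
      then have "0 \<le> 4 * ((1 + x) * ln (1 + x) - x)"
        using x by (simp add: field_simps)
      with dq[of x] x show "\<exists>y. DERIV q x :> y \<and> y \<ge> 0" by auto
    qed
    moreover have "0 \<le> 2 * \<bar>u\<bar> ^ 3" "q 0 = 0" by (simp_all add: q_def)
    ultimately show ?thesis by linarith
  next
    case False
    define w where "w = (\<lambda>u::real. q u - 2 * u ^ 3)"
    have "w u \<ge> w 0"
    proof (rule DERIV_nonpos_imp_nonincreasing[of u 0 w])
      fix x assume x: "u \<le> x" "x \<le> 0"
      have x1: "-1 < x" using x assms by simp
      have dw: "(w has_real_derivative 4 * ((1 + x) * ln (1 + x) - x) - 6 * x\<^sup>2) (at x)"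
        unfolding w_def by (rule derivative_eq_intros dq[OF x1] refl | simp)+
      have "(1 + x) * ln (1 + x) \<le> (1 + x) * x"
        using x1 ln_le_minus_one[of "1 + x"] by (intro mult_left_mono) auto
      then have "4 * ((1 + x) * ln (1 + x) - x) - 6 * x\<^sup>2 \<le> 4 * x\<^sup>2 - 6 * x\<^sup>2"
        by (simp add: algebra_simps power2_eq_square)
      also have "\<dots> \<le> 0" by simp
      finally show "\<exists>y. DERIV w x :> y \<and> y \<le> 0" using dw by blast
    qed (use False in simp)
    then show ?thesis using False by (simp add: w_def q_def power3_eq_cube)
  qed
  moreover have "ln ((1 + u)\<^sup>2) = 2 * ln (1 + u)"
    using assms by (simp add: ln_realpow)
  ultimately show ?thesis by (simp add: q_def algebra_simps)
qed

text \<open>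
  Both sides agree to first order at \<open>0\<close>, and the second derivative of their difference is
  nonnegative. The argument of the logarithm is \<open>(1 + h)\<^sup>2 + h\<^sup>2\<close>, the unnormalised comparison density
  of \<open>ent_shift_one_le\<close>.
\<close>
lemma linear_mult_ln_le:
  fixes h :: real
  shows "(1 + 2 * h) * ln (1 + 2 * h + 2 * h\<^sup>2) \<le> 2 * h + 6 * h\<^sup>2"
proof -
  define D :: "real \<Rightarrow> real" where "D = (\<lambda>h. 1 + 2 * h + 2 * h\<^sup>2)"
  have D2: "2 * D x = 1 + (1 + 2 * x)\<^sup>2" for x
    by (simp add: D_def power2_eq_square algebra_simps)
  have Dp: "0 < D x" for x using D2[of x] zero_le_power2[of "1 + 2 * x"] by linarith
  define w' where "w' = (\<lambda>h::real. 2 + 12 * h - (2 * ln (D h) + (1 + 2 * h) * ((2 + 4 * h) / D h)))"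
  define w where "w = (\<lambda>h::real. 2 * h + 6 * h\<^sup>2 - (1 + 2 * h) * ln (D h))"
  have dD: "(D has_real_derivative 2 + 4 * x) (at x)" for x
    unfolding D_def by (auto intro!: derivative_eq_intros)
  have dw: "(w has_real_derivative w' x) (at x)" for x
    unfolding w_def w'_def
    by (rule derivative_eq_intros dD refl Dp | simp add: Dp)+
  have alt: "w' = (\<lambda>h. 12 * h - 2 - 2 * ln (D h) + 2 * inverse (D h))"
  proof
    fix h
    have "(1 + 2 * h) * (2 + 4 * h) = 4 * D h - 2" using D2[of h] by (simp add: power2_eq_square algebra_simps)
    then have "(1 + 2 * h) * ((2 + 4 * h) / D h) = (4 * D h - 2) / D h" by simp
    also have "\<dots> = 4 - 2 * inverse (D h)" using Dp[of h] by (simp add: diff_divide_distrib inverse_eq_divide)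
    finally show "w' h = 12 * h - 2 - 2 * ln (D h) + 2 * inverse (D h)" by (simp add: w'_def)
  qed
  have dw': "\<exists>y. (w' has_real_derivative y) (at x) \<and> 0 \<le> y" for x
  proof -
    have "(w' has_real_derivative 12 - 2 * ((2 + 4 * x) / D x) - 2 * ((2 + 4 * x) / (D x * D x))) (at x)"
      unfolding alt using Dp[of x] by (auto intro!: derivative_eq_intros dD simp: divide_inverse)
    moreover have a: "2 + 4 * x \<le> 2 * D x" by (simp add: D_def)
    then have "(2 + 4 * x) / D x \<le> 2" using Dp[of x] by (simp add: pos_divide_le_eq)
    moreover have "(2 + 4 * x) / (D x * D x) \<le> 4"
    proof -
      have b: "1 \<le> 2 * D x" using D2[of x] by simp
      have "2 * D x \<le> 4 * (D x * D x)" using mult_right_mono[OF b, of "2 * D x"] Dp[of x] by simp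
      with a have "2 + 4 * x \<le> 4 * (D x * D x)" by linarith
      then show ?thesis using Dp[of x] by (simp add: pos_divide_le_eq)
    qed
    ultimately show ?thesis by (intro exI conjI) (assumption, linarith)
  qed
  have w'0: "w' 0 = 0" by (simp add: w'_def D_def)
  have "w h \<ge> 0"
  proof (cases "0 \<le> h")
    case True
    have "w 0 \<le> w h"
    proof (rule DERIV_nonneg_imp_nondecreasing[OF True])
      fix x assume "0 \<le> x" "x \<le> h"
      then have "w' 0 \<le> w' x" using DERIV_nonneg_imp_nondecreasing[of 0 x w'] dw' by auto
      with dw w'0 show "\<exists>y. DERIV w x :> y \<and> y \<ge> 0" by auto
    qed
    then show ?thesis by (simp add: w_def D_def)
  next
    case False
    have "w h \<ge> w 0"
    proof (rule DERIV_nonpos_imp_nonincreasing[of h 0 w])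
      fix x assume "h \<le> x" "x \<le> 0"
      then have "w' x \<le> w' 0" using DERIV_nonneg_imp_nondecreasing[of x 0 w'] dw' by auto
      with dw w'0 show "\<exists>y. DERIV w x :> y \<and> y \<le> 0" by auto
    qed (use False in simp)
    then show ?thesis by (simp add: w_def D_def)
  qed
  then show ?thesis by (simp add: w_def D_def)
qed

section \<open>Bounded measurable functions\<close>

text \<open>
  Nearly every integrand below is of this kind. The set depends on \<open>M\<close> through its \<open>\<sigma>\<close>-algebra alone, so
  it is shared by all the measures of a kernel and by their mixture.
\<close>
definition bmeas :: "'a measure \<Rightarrow> ('a \<Rightarrow> real) set" where
  "bmeas M = {f \<in> borel_measurable M. \<exists>B. \<forall>x\<in>space M. \<bar>f x\<bar> \<le> B}"

lemma bmeasI: "f \<in> borel_measurable M \<Longrightarrow> (\<And>x. x \<in> space M \<Longrightarrow> \<bar>f x\<bar> \<le> B) \<Longrightarrow> f \<in> bmeas M"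
  by (auto simp: bmeas_def)

lemma bmeas_measurable: "f \<in> bmeas M \<Longrightarrow> f \<in> borel_measurable M"
  by (simp add: bmeas_def)

lemma bmeas_bounded: "f \<in> bmeas M \<Longrightarrow> \<exists>B\<ge>0. \<forall>x\<in>space M. \<bar>f x\<bar> \<le> B"
  unfolding bmeas_def by (clarsimp, rule_tac x="max 0 B" in exI) (simp add: le_max_iff_disj)

lemma bmeas_cong_sets: "sets M = sets N \<Longrightarrow> bmeas M = bmeas N"
  using sets_eq_imp_space_eq[of M N] by (auto simp: bmeas_def measurable_cong_sets[of M N borel borel])

lemma bmeas_const: "(\<lambda>_. c) \<in> bmeas M"
  by (rule bmeasI) auto

lemma bmeas_add:
  assumes "f \<in> bmeas M" "g \<in> bmeas M" shows "(\<lambda>x. f x + g x) \<in> bmeas M"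
proof -
  obtain B where "0 \<le> B" "\<And>x. x \<in> space M \<Longrightarrow> \<bar>f x\<bar> \<le> B" using bmeas_bounded[OF assms(1)] by blast
  moreover obtain C where "0 \<le> C" "\<And>x. x \<in> space M \<Longrightarrow> \<bar>g x\<bar> \<le> C" using bmeas_bounded[OF assms(2)] by blast
  ultimately show ?thesis using assms[THEN bmeas_measurable]
    by (intro bmeasI[of _ _ "B + C"]) (auto intro: order_trans[OF abs_triangle_ineq] add_mono)
qed

lemma bmeas_mult:
  assumes "f \<in> bmeas M" "g \<in> bmeas M" shows "(\<lambda>x. f x * g x) \<in> bmeas M"
proof -
  obtain B where "0 \<le> B" "\<And>x. x \<in> space M \<Longrightarrow> \<bar>f x\<bar> \<le> B" using bmeas_bounded[OF assms(1)] by blast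
  moreover obtain C where "0 \<le> C" "\<And>x. x \<in> space M \<Longrightarrow> \<bar>g x\<bar> \<le> C" using bmeas_bounded[OF assms(2)] by blast
  ultimately show ?thesis using assms[THEN bmeas_measurable]
    by (intro bmeasI[of _ _ "B * C"]) (auto simp: abs_mult intro: mult_mono)
qed

lemma bmeas_diff: "f \<in> bmeas M \<Longrightarrow> g \<in> bmeas M \<Longrightarrow> (\<lambda>x. f x - g x) \<in> bmeas M"
  using bmeas_add[of f M "\<lambda>x. -1 * g x"] bmeas_mult[of "\<lambda>_. -1" M g] by (simp add: bmeas_const)

lemma bmeas_divide: "f \<in> bmeas M \<Longrightarrow> (\<lambda>x. f x / c) \<in> bmeas M"
  using bmeas_mult[of f M "\<lambda>_. inverse c"] by (simp add: bmeas_const divide_inverse)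

lemma bmeas_power: "f \<in> bmeas M \<Longrightarrow> (\<lambda>x. f x ^ n) \<in> bmeas M"
  by (induction n) (auto intro: bmeas_const bmeas_mult)

lemma bmeas_abs: "f \<in> bmeas M \<Longrightarrow> (\<lambda>x. \<bar>f x\<bar>) \<in> bmeas M"
  by (auto simp: bmeas_def)

lemma bmeas_mult_ln:
  assumes "f \<in> bmeas M" "\<And>x. x \<in> space M \<Longrightarrow> 0 \<le> f x"
  shows "(\<lambda>x. f x * ln (f x)) \<in> bmeas M"
proof -
  obtain B where B: "0 \<le> B" "\<And>x. x \<in> space M \<Longrightarrow> \<bar>f x\<bar> \<le> B" using bmeas_bounded[OF assms(1)] by blast
  have "\<bar>t * ln t\<bar> \<le> 1 + B * B" if t: "0 \<le> t" "t \<le> B" for t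
  proof (cases "t = 0")
    case False
    with t have "0 < t" by simp
    then have "ln (1 / t) \<le> 1 / t - 1" by (intro ln_le_minus_one) simp
    then have "- (t * ln t) \<le> 1 - t" using \<open>0 < t\<close> by (simp add: ln_div field_simps)
    moreover have "t * ln t \<le> B * B"
    proof -
      have "ln t \<le> B" using ln_le_minus_one[OF \<open>0 < t\<close>] t by linarith
      then have "t * ln t \<le> t * B" using t by (intro mult_left_mono)
      also have "\<dots> \<le> B * B" using t B(1) by (intro mult_right_mono)
      finally show ?thesis .
    qed
    moreover have "0 \<le> B * B" by simp
    ultimately show ?thesis using t by (simp only: abs_le_iff) linarith
  qed (simp add: B)
  note bound = this
  show ?thesis
  proof (rule bmeasI)
    show "(\<lambda>x. f x * ln (f x)) \<in> borel_measurable M"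
      using bmeas_measurable[OF assms(1)] by simp
    fix x assume x: "x \<in> space M"
    show "\<bar>f x * ln (f x)\<bar> \<le> 1 + B * B"
      using assms(2)[OF x] B(2)[OF x] by (intro bound) auto
  qed
qed

lemma bmeas_ln:
  assumes "f \<in> bmeas M" "0 < \<epsilon>" "\<And>x. x \<in> space M \<Longrightarrow> \<epsilon> \<le> f x"
  shows "(\<lambda>x. ln (f x)) \<in> bmeas M"
proof -
  obtain B where B: "0 \<le> B" "\<And>x. x \<in> space M \<Longrightarrow> \<bar>f x\<bar> \<le> B" using bmeas_bounded[OF assms(1)] by blast
  have "\<bar>ln (f x)\<bar> \<le> max (ln B) (- ln \<epsilon>)" if "x \<in> space M" for x
  proof -
    have "0 < f x" "f x \<le> B" "\<epsilon> \<le> f x" using assms(2) assms(3)[OF that] B(2)[OF that] by auto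
    then have "ln \<epsilon> \<le> ln (f x)" "ln (f x) \<le> ln B"
      using assms(2) by (simp_all add: ln_mono)
    then show ?thesis by linarith
  qed
  then show ?thesis using bmeas_measurable[OF assms(1)] by (intro bmeasI) auto
qed

lemmas bmeas_intros = bmeas_const bmeas_add bmeas_diff bmeas_mult bmeas_divide bmeas_power bmeas_abs

lemma (in finite_measure) bmeas_integrable:
  assumes "f \<in> bmeas M"
  shows "integrable M f"
proof -
  obtain B where "0 \<le> B" "\<And>x. x \<in> space M \<Longrightarrow> \<bar>f x\<bar> \<le> B" using bmeas_bounded[OF assms] by blast
  then show ?thesis
    by (intro integrable_const_bound[of f B] AE_I2 bmeas_measurable[OF assms]) simp
qed

section \<open>Entropy of bounded functions\<close>

context prob_space
begin

lemma bmeas_integral_eq_0: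
  assumes "F \<in> bmeas M" "\<And>x. x \<in> space M \<Longrightarrow> 0 \<le> F x" "(\<integral>x. F x \<partial>M) = 0"
  shows "AE x in M. F x = 0"
  using integral_nonneg_eq_0_iff_AE[OF bmeas_integrable[OF assms(1)] AE_I2[OF assms(2)]] assms(3) by simp

text \<open>
  The easy half of the Donsker--Varadhan formula: integrate \<open>ln z \<le> z - 1\<close> at
  \<open>z = k * S / F\<close> against \<open>F\<close>, where \<open>S\<close> is the mean of \<open>F\<close>.
\<close>
lemma ent_variational:
  assumes F: "F \<in> bmeas M" "\<And>x. x \<in> space M \<Longrightarrow> 0 \<le> F x"
    and k: "k \<in> bmeas M" "0 < \<epsilon>" "\<And>x. x \<in> space M \<Longrightarrow> \<epsilon> \<le> k x" "(\<integral>x. k x \<partial>M) \<le> 1"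
  shows "(\<integral>x. F x * ln (k x) \<partial>M) \<le> ent M F"
proof -
  define S where "S = (\<integral>x. F x \<partial>M)"
  have "0 \<le> S" unfolding S_def by (intro Bochner_Integration.integral_nonneg F)
  then consider "S = 0" | "0 < S" by linarith
  then show ?thesis
  proof cases
    case 1
    then have 0: "AE x in M. F x = 0" using bmeas_integral_eq_0 F unfolding S_def by blast
    note [measurable] = F(1)[THEN bmeas_measurable] k(1)[THEN bmeas_measurable]
    have "AE x in M. F x * ln (k x) = 0" "AE x in M. F x * ln (F x) = 0"
      using 0 by (eventually_elim, simp)+
    then have "(\<integral>x. F x * ln (k x) \<partial>M) = 0" "(\<integral>x. F x * ln (F x) \<partial>M) = 0"
      by (simp_all add: integral_eq_zero_AE)
    then show ?thesis using 1 unfolding ent_def S_def by simp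
  next
    case 2
    have ln_k: "(\<lambda>x. ln (k x)) \<in> bmeas M" by (rule bmeas_ln[OF k(1,2,3)])
    have FlnF: "(\<lambda>x. F x * ln (F x)) \<in> bmeas M" by (rule bmeas_mult_ln[OF F])
    note int = bmeas_integrable[OF FlnF] bmeas_integrable[OF F(1)] bmeas_integrable[OF k(1)]
    have "(\<integral>x. F x * ln (k x) \<partial>M) \<le> (\<integral>x. F x * ln (F x) - F x * ln S + S * k x - F x \<partial>M)"
    proof (rule integral_mono)
      fix x assume x: "x \<in> space M"
      show "F x * ln (k x) \<le> F x * ln (F x) - F x * ln S + S * k x - F x"
      proof (cases "F x = 0")
        case True
        then show ?thesis using 2 k(2) k(3)[OF x] by simp
      next
        case False
        then have "0 < F x" using F(2)[OF x] by simp
        moreover have "0 < k x" using k(2) k(3)[OF x] by simp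
        ultimately have "ln (k x) \<le> ln (F x / S) + k x / (F x / S) - 1"
          using 2 by (intro ln_le_tangent) auto
        then have "F x * ln (k x) \<le> F x * (ln (F x / S) + k x / (F x / S) - 1)"
          using \<open>0 < F x\<close> by (intro mult_left_mono) auto
        then show ?thesis using 2 \<open>0 < F x\<close> by (simp add: ln_div algebra_simps)
      qed
    next
      show "integrable M (\<lambda>x. F x * ln (k x))"
        by (rule bmeas_integrable[OF bmeas_mult[OF F(1) ln_k]])
      show "integrable M (\<lambda>x. F x * ln (F x) - F x * ln S + S * k x - F x)"
        using int by simp
    qed
    also have "\<dots> = (\<integral>x. F x * ln (F x) \<partial>M) - S * ln S + S * (\<integral>x. k x \<partial>M) - S"
      using int by (simp add: S_def)
    also have "\<dots> \<le> ent M F"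
      unfolding ent_def S_def[symmetric] using mult_left_mono[OF k(4), of S] 2 by simp
    finally show ?thesis .
  qed
qed

lemma ent_nonneg:
  assumes "F \<in> bmeas M" "\<And>x. x \<in> space M \<Longrightarrow> 0 \<le> F x"
  shows "0 \<le> ent M F"
  using ent_variational[OF assms, where k="\<lambda>_. 1" and \<epsilon>=1]
  by (simp add: bmeas_const prob_space)

lemma ent_cmult:
  assumes "F \<in> bmeas M" "\<And>x. x \<in> space M \<Longrightarrow> 0 \<le> F x" "0 < c"
  shows "ent M (\<lambda>x. c * F x) = c * ent M F"
proof -
  note FlnF = bmeas_mult_ln[OF assms(1,2)]
  define S where "S = (\<integral>x. F x \<partial>M)"
  have "0 \<le> S" unfolding S_def by (intro Bochner_Integration.integral_nonneg assms)
  have ln_c: "a * ln (c * a) = ln c * a + a * ln a" if "0 \<le> a" for a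
    using that assms(3) by (cases "a = 0") (auto simp: ln_mult algebra_simps)
  have "(\<integral>x. c * F x * ln (c * F x) \<partial>M) = (\<integral>x. c * (ln c * F x + F x * ln (F x)) \<partial>M)"
    by (intro Bochner_Integration.integral_cong) (auto simp: mult.assoc ln_c assms(2))
  also have "\<dots> = c * (ln c * S + (\<integral>x. F x * ln (F x) \<partial>M))"
    using assms(1) FlnF by (simp add: bmeas_integrable bmeas_intros S_def)
  finally have "ent M (\<lambda>x. c * F x) = c * (ln c * S + (\<integral>x. F x * ln (F x) \<partial>M)) - c * (S * ln (c * S))"
    unfolding ent_def by (simp add: S_def)
  then show ?thesis
    unfolding ln_c[OF \<open>0 \<le> S\<close>] ent_def S_def[symmetric] by (simp add: algebra_simps)
qed

text \<open>
  Bound the entropy of \<open>h\<^sup>2\<close> from below by the variational formula with density proportional to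
  \<open>d = (1 + h)\<^sup>2 + h\<^sup>2\<close>, and the entropy of \<open>(1 + h)\<^sup>2\<close> from above by replacing \<open>ln ((1 + h)\<^sup>2)\<close> with \<open>ln d\<close>.
  The difference of the two bounds exceeds the mean of \<open>(1 + 2 * h) * ln d\<close> by at most \<open>s\<close>, the mean of
  \<open>h\<^sup>2\<close>, which is the price of normalising. The density \<open>d\<close> is chosen because it is bounded away from \<open>0\<close>,
  also near \<open>h = -1\<close>; that mean is then at most \<open>6 * s\<close> by \<open>linear_mult_ln_le\<close>.
\<close>
lemma ent_shift_one_le:
  assumes h: "h \<in> bmeas M" and h0: "(\<integral>x. h x \<partial>M) = 0"
  shows "ent M (\<lambda>x. (1 + h x)\<^sup>2) \<le> ent M (\<lambda>x. (h x)\<^sup>2) + 7 * (\<integral>x. (h x)\<^sup>2 \<partial>M)"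
proof -
  define s where "s = (\<integral>x. (h x)\<^sup>2 \<partial>M)"
  define t where "t = 1 + s"
  have s: "0 \<le> s" unfolding s_def by simp
  have t: "(\<integral>x. (1 + h x)\<^sup>2 \<partial>M) = t"
  proof -
    have "(\<integral>x. (1 + h x)\<^sup>2 \<partial>M) = (\<integral>x. 1 + 2 * h x + (h x)\<^sup>2 \<partial>M)"
      by (simp add: power2_eq_square algebra_simps)
    also have "\<dots> = t" using h h0
      by (simp add: bmeas_integrable bmeas_intros prob_space s_def t_def)
    finally show ?thesis .
  qed
  define d where "d = (\<lambda>x. (1 + h x)\<^sup>2 + (h x)\<^sup>2)"
  have d_eq: "d x = 1 + 2 * h x + 2 * (h x)\<^sup>2" for x by (simp add: d_def power2_eq_square algebra_simps)
  have d_ge: "1 / 2 \<le> d x" for x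
  proof -
    have "0 \<le> (1 + 2 * h x)\<^sup>2" by simp
    then show ?thesis unfolding d_eq by (simp add: power2_eq_square algebra_simps)
  qed
  have d: "d \<in> bmeas M" unfolding d_def by (intro bmeas_intros h)
  have ln_d: "(\<lambda>x. ln (d x)) \<in> bmeas M" by (rule bmeas_ln[OF d, of "1/2"]) (use d_ge in auto)
  have f2: "(\<lambda>x. (1 + h x)\<^sup>2) \<in> bmeas M" and h2: "(\<lambda>x. (h x)\<^sup>2) \<in> bmeas M" by (intro bmeas_intros h)+
  have f2ln: "(\<lambda>x. (1 + h x)\<^sup>2 * ln ((1 + h x)\<^sup>2)) \<in> bmeas M" by (rule bmeas_mult_ln[OF f2]) simp
  have dint: "(\<integral>x. d x \<partial>M) = 1 + 2 * s"
    unfolding d_def using f2 h2 by (simp add: bmeas_integrable t[unfolded t_def] s_def[symmetric])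
  have lower: "(\<integral>x. (h x)\<^sup>2 * ln (d x) \<partial>M) - s * ln (1 + 2 * s) \<le> ent M (\<lambda>x. (h x)\<^sup>2)"
  proof -
    have "(\<integral>x. (h x)\<^sup>2 * ln (d x / (1 + 2 * s)) \<partial>M) \<le> ent M (\<lambda>x. (h x)\<^sup>2)"
      using s d_ge by (intro ent_variational[where \<epsilon>="(1/2) / (1 + 2 * s)"] h2 bmeas_intros d divide_right_mono)
         (auto simp: dint)
    also have "(\<integral>x. (h x)\<^sup>2 * ln (d x / (1 + 2 * s)) \<partial>M) = (\<integral>x. (h x)\<^sup>2 * ln (d x) - (h x)\<^sup>2 * ln (1 + 2 * s) \<partial>M)"
    proof (rule Bochner_Integration.integral_cong[OF refl])
      fix x
      have "0 < d x" using d_ge[of x] by linarith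
      then show "(h x)\<^sup>2 * ln (d x / (1 + 2 * s)) = (h x)\<^sup>2 * ln (d x) - (h x)\<^sup>2 * ln (1 + 2 * s)"
        using s by (simp add: ln_div algebra_simps)
    qed
    also have "\<dots> = (\<integral>x. (h x)\<^sup>2 * ln (d x) \<partial>M) - s * ln (1 + 2 * s)"
      using h2 ln_d by (simp add: bmeas_integrable bmeas_intros s_def)
    finally show ?thesis .
  qed
  have "ent M (\<lambda>x. (1 + h x)\<^sup>2) \<le> (\<integral>x. (1 + h x)\<^sup>2 * ln (d x) \<partial>M) - t * ln t"
  proof -
    have "(\<integral>x. (1 + h x)\<^sup>2 * ln ((1 + h x)\<^sup>2) \<partial>M) \<le> (\<integral>x. (1 + h x)\<^sup>2 * ln (d x) \<partial>M)"
    proof (rule integral_mono)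
      fix x
      show "(1 + h x)\<^sup>2 * ln ((1 + h x)\<^sup>2) \<le> (1 + h x)\<^sup>2 * ln (d x)"
        by (cases "1 + h x = 0") (auto intro!: mult_left_mono ln_mono simp: d_def)
    qed (intro bmeas_integrable f2ln bmeas_mult f2 ln_d)+
    then show ?thesis unfolding ent_def t by simp
  qed
  also have "(\<integral>x. (1 + h x)\<^sup>2 * ln (d x) \<partial>M) =
      (\<integral>x. (1 + 2 * h x) * ln (d x) \<partial>M) + (\<integral>x. (h x)\<^sup>2 * ln (d x) \<partial>M)"
  proof -
    have "(1 + h x)\<^sup>2 * ln (d x) = (1 + 2 * h x) * ln (d x) + (h x)\<^sup>2 * ln (d x)" for x
      by (simp add: power2_eq_square algebra_simps)
    then have "(\<integral>x. (1 + h x)\<^sup>2 * ln (d x) \<partial>M) = (\<integral>x. (1 + 2 * h x) * ln (d x) + (h x)\<^sup>2 * ln (d x) \<partial>M)"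
      by (rule Bochner_Integration.integral_cong[OF refl])
    also have "\<dots> = (\<integral>x. (1 + 2 * h x) * ln (d x) \<partial>M) + (\<integral>x. (h x)\<^sup>2 * ln (d x) \<partial>M)"
      by (intro Bochner_Integration.integral_add bmeas_integrable bmeas_intros h ln_d)
    finally show ?thesis .
  qed
  also have "(\<integral>x. (1 + 2 * h x) * ln (d x) \<partial>M) \<le> (\<integral>x. 2 * h x + 6 * (h x)\<^sup>2 \<partial>M)"
    using linear_mult_ln_le by (intro integral_mono bmeas_integrable bmeas_intros h ln_d) (auto simp: d_eq)
  also have "(\<integral>x. 2 * h x + 6 * (h x)\<^sup>2 \<partial>M) = 6 * s"
    using h h2 by (simp add: bmeas_integrable bmeas_intros h0 s_def)
  finally have 1: "ent M (\<lambda>x. (1 + h x)\<^sup>2) \<le> 6 * s + (\<integral>x. (h x)\<^sup>2 * ln (d x) \<partial>M) - t * ln t" by simp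
  have "t * ln (1 + 2 * s) \<le> t * (ln t + (1 + 2 * s) / t - 1)"
    using s by (intro mult_left_mono ln_le_tangent) (auto simp: t_def)
  also have "\<dots> = t * ln t + t * ((1 + 2 * s) / t) - t" by (simp add: algebra_simps)
  also have "t * ((1 + 2 * s) / t) = 1 + 2 * s" using s by (simp add: t_def)
  finally have "(1 + s) * ln (1 + 2 * s) \<le> t * ln t + s" by (simp add: t_def)
  moreover have "0 \<le> ln (1 + 2 * s)" using s by simp
  ultimately have "s * ln (1 + 2 * s) \<le> t * ln t + s" unfolding distrib_right by simp
  with 1 lower show ?thesis by (simp add: s_def[symmetric])
qed

text \<open>
  Rothaus' inequality with the constant \<open>7\<close> in place of the optimal \<open>2\<close>. It reduces to the case
  \<open>a = 1\<close> because both sides are homogeneous of degree two in \<open>(a, h)\<close>.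
\<close>
lemma ent_shift_le:
  assumes h: "h \<in> bmeas M" and h0: "(\<integral>x. h x \<partial>M) = 0"
  shows "ent M (\<lambda>x. (a + h x)\<^sup>2) \<le> ent M (\<lambda>x. (h x)\<^sup>2) + 7 * (\<integral>x. (h x)\<^sup>2 \<partial>M)"
proof (cases "a = 0")
  case False
  define g where "g = (\<lambda>x. h x / a)"
  have g: "g \<in> bmeas M" unfolding g_def by (intro bmeas_intros h)
  have "h x = a * g x" for x using False by (simp add: g_def)
  then have eq: "(\<lambda>x. (a + h x)\<^sup>2) = (\<lambda>x. a\<^sup>2 * (1 + g x)\<^sup>2)" "(\<lambda>x. (h x)\<^sup>2) = (\<lambda>x. a\<^sup>2 * (g x)\<^sup>2)"
    by (simp_all add: fun_eq_iff power2_eq_square algebra_simps)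
  have "ent M (\<lambda>x. (1 + g x)\<^sup>2) \<le> ent M (\<lambda>x. (g x)\<^sup>2) + 7 * (\<integral>x. (g x)\<^sup>2 \<partial>M)"
    by (rule ent_shift_one_le[OF g]) (simp add: g_def h0)
  then have "a\<^sup>2 * ent M (\<lambda>x. (1 + g x)\<^sup>2) \<le> a\<^sup>2 * (ent M (\<lambda>x. (g x)\<^sup>2) + 7 * (\<integral>x. (g x)\<^sup>2 \<partial>M))"
    by (intro mult_left_mono) auto
  moreover have "ent M (\<lambda>x. a\<^sup>2 * (1 + g x)\<^sup>2) = a\<^sup>2 * ent M (\<lambda>x. (1 + g x)\<^sup>2)"
      "ent M (\<lambda>x. a\<^sup>2 * (g x)\<^sup>2) = a\<^sup>2 * ent M (\<lambda>x. (g x)\<^sup>2)"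
    using False by (auto intro!: ent_cmult bmeas_power bmeas_add bmeas_const g)
  ultimately show ?thesis unfolding eq by (simp add: algebra_simps)
qed simp

text \<open>
  As \<open>\<epsilon>\<close> tends to \<open>0\<close>, the entropy of \<open>(1 + \<epsilon> * h)\<^sup>2\<close> is \<open>2 * \<epsilon>\<^sup>2\<close> times the variance of \<open>h\<close>, up to an error of
  order \<open>\<epsilon>\<^sup>3\<close>.
\<close>
lemma variance_le_ent_linearised:
  assumes h: "h \<in> bmeas M" and h0: "(\<integral>x. h x \<partial>M) = 0"
    and D: "\<And>\<epsilon>. 0 < \<epsilon> \<Longrightarrow> ent M (\<lambda>x. (1 + \<epsilon> * h x)\<^sup>2) \<le> 2 * \<epsilon>\<^sup>2 * D"
  shows "(\<integral>x. (h x)\<^sup>2 \<partial>M) \<le> D"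
proof -
  define s where "s = (\<integral>x. (h x)\<^sup>2 \<partial>M)"
  define c where "c = (\<integral>x. \<bar>h x\<bar> ^ 3 \<partial>M)"
  have s: "0 \<le> s" unfolding s_def by simp
  obtain B where B: "0 \<le> B" "\<And>x. x \<in> space M \<Longrightarrow> \<bar>h x\<bar> \<le> B" using bmeas_bounded[OF h] by blast
  \<comment> \<open>The bound on \<open>\<epsilon>\<close> keeps \<open>1 + \<epsilon> * h\<close> positive, as the cubic estimate requires.\<close>
  have key: "2 * s - 2 * \<epsilon> * c - \<epsilon>\<^sup>2 * s\<^sup>2 \<le> 2 * D" if \<epsilon>: "0 < \<epsilon>" "\<epsilon> < 1 / (1 + B)" for \<epsilon>
  proof -
    have u1: "-1 < \<epsilon> * h x" if "x \<in> space M" for x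
    proof -
      have "\<epsilon> * \<bar>h x\<bar> \<le> \<epsilon> * B" using \<epsilon> B(2)[OF that] by (intro mult_left_mono) auto
      also have "\<dots> < 1" using \<epsilon> B(1) by (simp add: field_simps)
      finally have "\<bar>\<epsilon> * h x\<bar> < 1" using \<epsilon> by (simp add: abs_mult)
      then show ?thesis by linarith
    qed
    define F where "F = (\<lambda>x. (1 + \<epsilon> * h x)\<^sup>2)"
    have F: "F \<in> bmeas M" unfolding F_def by (intro bmeas_intros h)
    have FlnF: "(\<lambda>x. F x * ln (F x)) \<in> bmeas M" by (rule bmeas_mult_ln[OF F]) (simp add: F_def)
    have Fint: "(\<integral>x. F x \<partial>M) = 1 + \<epsilon>\<^sup>2 * s"
    proof -
      have "F = (\<lambda>x. 1 + 2 * \<epsilon> * h x + \<epsilon>\<^sup>2 * (h x)\<^sup>2)"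
        by (simp add: F_def fun_eq_iff power2_eq_square algebra_simps)
      then show ?thesis using h h0 by (simp add: bmeas_integrable bmeas_intros s_def prob_space)
    qed
    have "3 * \<epsilon>\<^sup>2 * s - 2 * \<epsilon> ^ 3 * c
        = (\<integral>x. 2 * \<epsilon> * h x + 3 * \<epsilon>\<^sup>2 * (h x)\<^sup>2 - 2 * \<epsilon> ^ 3 * \<bar>h x\<bar> ^ 3 \<partial>M)"
      using h h0 by (simp add: bmeas_integrable bmeas_intros s_def c_def)
    also have "\<dots> \<le> (\<integral>x. F x * ln (F x) \<partial>M)"
    proof (rule integral_mono)
      fix x assume x: "x \<in> space M"
      show "2 * \<epsilon> * h x + 3 * \<epsilon>\<^sup>2 * (h x)\<^sup>2 - 2 * \<epsilon> ^ 3 * \<bar>h x\<bar> ^ 3 \<le> F x * ln (F x)"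
        using mult_ln_lower_cubic[OF u1[OF x]] \<epsilon>
        by (simp add: F_def power_mult_distrib abs_mult mult.assoc)
    qed (intro bmeas_integrable bmeas_intros h FlnF)+
    finally have a: "3 * \<epsilon>\<^sup>2 * s - 2 * \<epsilon> ^ 3 * c \<le> (\<integral>x. F x * ln (F x) \<partial>M)" .
    define w where "w = \<epsilon>\<^sup>2 * s"
    have w: "0 \<le> w" unfolding w_def using s by simp
    have b: "(1 + w) * ln (1 + w) \<le> (1 + w) * w"
      using w ln_le_minus_one[of "1 + w"] by (intro mult_left_mono) auto
    have "3 * w - 2 * \<epsilon> ^ 3 * c - (1 + w) * w \<le> ent M F"
      using a b unfolding ent_def Fint w_def[symmetric] by (simp add: w_def)
    also have "\<dots> \<le> 2 * \<epsilon>\<^sup>2 * D" unfolding F_def by (rule D) (use \<epsilon> in simp)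
    finally have "\<epsilon>\<^sup>2 * (2 * s - 2 * \<epsilon> * c - \<epsilon>\<^sup>2 * s\<^sup>2) \<le> \<epsilon>\<^sup>2 * (2 * D)"
      by (simp add: w_def algebra_simps power2_eq_square power3_eq_cube)
    then show ?thesis using \<epsilon> by simp
  qed
  have "2 * s \<le> 2 * D"
  proof (rule tendsto_le)
    show "((\<lambda>\<epsilon>. 2 * s - 2 * \<epsilon> * c - \<epsilon>\<^sup>2 * s\<^sup>2) \<longlongrightarrow> 2 * s) (at_right 0)"
      by (auto intro!: tendsto_eq_intros)
    show "((\<lambda>_. 2 * D) \<longlongrightarrow> 2 * D) (at_right 0)" by simp
    have "\<forall>\<^sub>F \<epsilon> in at_right 0. \<epsilon> \<in> {0<..<1 / (1 + B)}"
      using B(1) by (intro eventually_at_right_real) auto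
    then show "\<forall>\<^sub>F \<epsilon> in at_right 0. 2 * s - 2 * \<epsilon> * c - \<epsilon>\<^sup>2 * s\<^sup>2 \<le> 2 * D"
      by eventually_elim (use key in auto)
  qed simp
  then show ?thesis by (simp add: s_def)
qed

end

section \<open>Lower bounds for the chi-squared divergence\<close>

text \<open>
  The identity \<open>1 + chi2 = \<integral> r\<^sup>2\<close> is the form in which the divergence is compared with other integrals.
\<close>
lemma chi2_density:
  assumes "prob_space \<rho>1" "prob_space \<rho>2" and sets: "sets \<rho>1 = sets \<rho>2" and fin: "chi2 \<rho>1 \<rho>2 < \<infinity>"
  obtains r where "r \<in> borel_measurable \<rho>2" "\<forall>y. 0 \<le> r y" "\<rho>1 = density \<rho>2 (\<lambda>y. ennreal (r y))"
    "integrable \<rho>2 r" "(\<integral>y. r y \<partial>\<rho>2) = 1" "integrable \<rho>2 (\<lambda>y. (r y)\<^sup>2)"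
    "1 + chi2 \<rho>1 \<rho>2 = ennreal (\<integral>y. (r y)\<^sup>2 \<partial>\<rho>2)"
proof -
  interpret r1: prob_space \<rho>1 by fact
  interpret r2: prob_space \<rho>2 by fact
  have ac: "absolutely_continuous \<rho>2 \<rho>1" using fin by (auto simp: chi2_def split: if_splits)
  define r where "r = (\<lambda>y. enn2real (RN_deriv \<rho>2 \<rho>1 y))"
  have r[measurable]: "r \<in> borel_measurable \<rho>2" unfolding r_def by measurable
  have r0: "0 \<le> r y" for y by (simp add: r_def)
  have chi: "chi2 \<rho>1 \<rho>2 = (\<integral>\<^sup>+ y. ennreal ((r y - 1)\<^sup>2) \<partial>\<rho>2)"
    using ac by (simp add: chi2_def r_def)
  have "AE y in \<rho>2. RN_deriv \<rho>2 \<rho>1 y \<noteq> \<infinity>"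
    by (rule r2.RN_deriv_finite[OF r1.sigma_finite_measure_axioms ac sets])
  then have "AE y in \<rho>2. RN_deriv \<rho>2 \<rho>1 y = ennreal (r y)"
    by eventually_elim (simp add: r_def top.not_eq_extremum)
  then have "density \<rho>2 (RN_deriv \<rho>2 \<rho>1) = density \<rho>2 (\<lambda>y. ennreal (r y))"
    by (intro density_cong) auto
  then have dens: "\<rho>1 = density \<rho>2 (\<lambda>y. ennreal (r y))"
    using r2.density_RN_deriv[OF ac sets] by simp
  have one: "(\<integral>\<^sup>+ y. ennreal (r y) \<partial>\<rho>2) = 1"
  proof -
    have "emeasure (density \<rho>2 (\<lambda>y. ennreal (r y))) (space \<rho>2) = (\<integral>\<^sup>+ y. ennreal (r y) \<partial>\<rho>2)"
      by (subst emeasure_density) (auto intro!: nn_integral_cong)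
    then show ?thesis
      using r1.emeasure_space_1 sets_eq_imp_space_eq[OF sets] dens by simp
  qed
  have int: "integrable \<rho>2 r" by (rule integrableI_nonneg) (auto simp: r0 one)
  have int1: "(\<integral>y. r y \<partial>\<rho>2) = 1"
    using one by (subst integral_eq_nn_integral) (auto simp: r0)
  have int2: "integrable \<rho>2 (\<lambda>y. (r y - 1)\<^sup>2)"
    by (rule integrableI_nonneg) (use fin chi in auto)
  have sq: "(r y)\<^sup>2 = (r y - 1)\<^sup>2 + 2 * r y - 1" for y by (simp add: power2_eq_square algebra_simps)
  have int3: "integrable \<rho>2 (\<lambda>y. (r y)\<^sup>2)" unfolding sq using int int2 by simp
  have "(\<integral>y. (r y)\<^sup>2 \<partial>\<rho>2) = (\<integral>y. (r y - 1)\<^sup>2 \<partial>\<rho>2) + 1"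
    unfolding sq using int int2 int1 by (simp add: r2.prob_space)
  moreover have "chi2 \<rho>1 \<rho>2 = ennreal (\<integral>y. (r y - 1)\<^sup>2 \<partial>\<rho>2)"
    unfolding chi by (rule nn_integral_eq_integral[OF int2]) simp
  ultimately have "1 + chi2 \<rho>1 \<rho>2 = ennreal (\<integral>y. (r y)\<^sup>2 \<partial>\<rho>2)"
    by (simp add: ennreal_plus add.commute flip: ennreal_1)
  then show thesis using r r0 dens int int1 int3 by (intro that[of r]) auto
qed

lemma (in prob_space) integrable_mult_bmeas:
  assumes "integrable M r" "\<psi> \<in> bmeas M"
  shows "integrable M (\<lambda>y. r y * \<psi> y :: real)"
proof -
  obtain B where B: "0 \<le> B" "\<And>x. x \<in> space M \<Longrightarrow> \<bar>\<psi> x\<bar> \<le> B" using bmeas_bounded[OF assms(2)] by blast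
  show ?thesis
  proof (rule Bochner_Integration.integrable_bound)
    show "integrable M (\<lambda>y. r y * B)" using assms(1) by simp
    show "(\<lambda>y. r y * \<psi> y) \<in> borel_measurable M"
      using bmeas_measurable[OF assms(2)] borel_measurable_integrable[OF assms(1)] by simp
    show "AE y in M. norm (r y * \<psi> y) \<le> norm (r y * B)"
      using B by (intro AE_I2) (auto simp: abs_mult intro!: mult_left_mono)
  qed
qed

text \<open>
  Integrate \<open>2 * r * \<psi> - \<psi>\<^sup>2 \<le> r\<^sup>2\<close>, with \<open>r\<close> the density of \<open>\<rho>1\<close>. The optimal \<open>\<psi>\<close> is \<open>r\<close> itself.
\<close>
lemma chi2_variational:
  assumes p: "prob_space \<rho>1" "prob_space \<rho>2" and sets: "sets \<rho>1 = sets \<rho>2" and \<psi>: "\<psi> \<in> bmeas \<rho>2"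
  shows "ennreal (2 * (\<integral>y. \<psi> y \<partial>\<rho>1) - (\<integral>y. (\<psi> y)\<^sup>2 \<partial>\<rho>2)) \<le> 1 + chi2 \<rho>1 \<rho>2"
proof (cases "chi2 \<rho>1 \<rho>2 < \<infinity>")
  case True
  interpret r2: prob_space \<rho>2 by fact
  obtain r where r: "r \<in> borel_measurable \<rho>2" "\<forall>y. 0 \<le> r y" "\<rho>1 = density \<rho>2 (\<lambda>y. ennreal (r y))"
    "integrable \<rho>2 r" "(\<integral>y. r y \<partial>\<rho>2) = 1" "integrable \<rho>2 (\<lambda>y. (r y)\<^sup>2)"
    "1 + chi2 \<rho>1 \<rho>2 = ennreal (\<integral>y. (r y)\<^sup>2 \<partial>\<rho>2)"
    by (rule chi2_density[OF p sets True])
  note [measurable] = bmeas_measurable[OF \<psi>] r(1)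
  have eq: "(\<integral>y. \<psi> y \<partial>\<rho>1) = (\<integral>y. r y * \<psi> y \<partial>\<rho>2)"
    unfolding r(3) by (subst integral_density) (auto simp: r(2))
  note int = r2.integrable_mult_bmeas[OF r(4) \<psi>] r2.bmeas_integrable[OF bmeas_power[OF \<psi>, of 2]]
  have "2 * (\<integral>y. r y * \<psi> y \<partial>\<rho>2) - (\<integral>y. (\<psi> y)\<^sup>2 \<partial>\<rho>2) = (\<integral>y. 2 * (r y * \<psi> y) - (\<psi> y)\<^sup>2 \<partial>\<rho>2)"
    using int by simp
  also have "\<dots> \<le> (\<integral>y. (r y)\<^sup>2 \<partial>\<rho>2)"
  proof (rule integral_mono)
    fix y
    show "2 * (r y * \<psi> y) - (\<psi> y)\<^sup>2 \<le> (r y)\<^sup>2"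
      using zero_le_power2[of "r y - \<psi> y"] by (simp add: power2_eq_square algebra_simps)
  qed (use int r(6) in simp_all)
  finally show ?thesis unfolding eq r(7) by (intro ennreal_leI)
qed (simp add: not_less top_unique)

text \<open>
  Let \<open>g1\<close> and \<open>g2\<close> be the two means of \<open>F\<close>, \<open>r\<close> the density of \<open>\<rho>1\<close> and \<open>Z = 1 + chi2\<close>. Tilting both
  measures by \<open>F\<close> suggests \<open>g1 * ln (g1 / g2) \<le> ent \<rho>1 F + g1 * ln Z\<close>; it follows by adding the
  inequalities \<open>ln z \<le> z - 1\<close> at \<open>z = g1 * r / (F * Z)\<close> and at \<open>z = g1 / (r * g2)\<close>, weighted by \<open>F * r\<close>, since
  the logarithms of \<open>r\<close> cancel and both right-hand sides integrate to \<open>0\<close>. A free number \<open>S\<close> is used here in place of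
  \<open>g2\<close>, which replaces \<open>ln g2\<close> by its tangent at \<open>S\<close>. The bound is then linear in \<open>g2\<close>
  and makes sense for \<open>g2 = 0\<close>.
\<close>
lemma chi2_entropic:
  assumes p: "prob_space \<rho>1" "prob_space \<rho>2" and sets: "sets \<rho>1 = sets \<rho>2"
    and F: "F \<in> bmeas \<rho>2" "\<And>y. y \<in> space \<rho>2 \<Longrightarrow> 0 \<le> F y"
    and g: "0 < (\<integral>y. F y \<partial>\<rho>1)" and S: "0 < S"
  shows "ennreal (exp (ln ((\<integral>y. F y \<partial>\<rho>1) / S) + 1 - (\<integral>y. F y \<partial>\<rho>2) / S - ent \<rho>1 F / (\<integral>y. F y \<partial>\<rho>1)))
    \<le> 1 + chi2 \<rho>1 \<rho>2"
proof (cases "chi2 \<rho>1 \<rho>2 < \<infinity>")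
  case True
  interpret r2: prob_space \<rho>2 by fact
  obtain r where r: "r \<in> borel_measurable \<rho>2" "\<forall>y. 0 \<le> r y" "\<rho>1 = density \<rho>2 (\<lambda>y. ennreal (r y))"
    "integrable \<rho>2 r" "(\<integral>y. r y \<partial>\<rho>2) = 1" "integrable \<rho>2 (\<lambda>y. (r y)\<^sup>2)"
    "1 + chi2 \<rho>1 \<rho>2 = ennreal (\<integral>y. (r y)\<^sup>2 \<partial>\<rho>2)"
    by (rule chi2_density[OF p sets True])
  define g1 where "g1 = (\<integral>y. F y \<partial>\<rho>1)"
  define g2 where "g2 = (\<integral>y. F y \<partial>\<rho>2)"
  define Z where "Z = (\<integral>y. (r y)\<^sup>2 \<partial>\<rho>2)"
  have "1 \<le> ennreal Z" unfolding Z_def r(7)[symmetric] by simp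
  then have Z: "1 \<le> Z" by simp
  have g1: "0 < g1" using g by (simp add: g1_def)
  have FlnF: "(\<lambda>y. F y * ln (F y)) \<in> bmeas \<rho>2" by (rule bmeas_mult_ln[OF F])
  note [measurable] = bmeas_measurable[OF F(1)] r(1)
  have e1: "g1 = (\<integral>y. r y * F y \<partial>\<rho>2)"
    unfolding g1_def r(3) by (subst integral_density) (auto simp: r(2))
  have e2: "(\<integral>y. F y * ln (F y) \<partial>\<rho>1) = (\<integral>y. r y * (F y * ln (F y)) \<partial>\<rho>2)"
    unfolding r(3) by (subst integral_density) (auto simp: r(2))
  define L where "L = 2 * ln g1 - ln Z - ln S"
  note int = r2.integrable_mult_bmeas[OF r(4) F(1)] r2.integrable_mult_bmeas[OF r(4) FlnF] r2.bmeas_integrable[OF F(1)] r(6)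
  have "g1 * L - (\<integral>y. F y * ln (F y) \<partial>\<rho>1) = (\<integral>y. r y * F y * L - r y * (F y * ln (F y)) \<partial>\<rho>2)"
    unfolding e2 using int by (simp add: e1[symmetric])
  also have "\<dots> \<le> (\<integral>y. g1 / Z * (r y)\<^sup>2 + g1 / S * F y - 2 * (r y * F y) \<partial>\<rho>2)"
  proof (rule integral_mono)
    fix y assume y: "y \<in> space \<rho>2"
    show "r y * F y * L - r y * (F y * ln (F y)) \<le> g1 / Z * (r y)\<^sup>2 + g1 / S * F y - 2 * (r y * F y)"
    proof (cases "r y = 0 \<or> F y = 0")
      case True
      have "0 \<le> g1 / Z * (r y)\<^sup>2" "0 \<le> g1 / S * F y" using g1 Z S F(2)[OF y] by auto
      with True show ?thesis by auto
    next
      case False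
      then have ry: "0 < r y" and Fy: "0 < F y" using r(2)[rule_format, of y] F(2)[OF y] by auto
      have "ln (g1 * r y / Z) \<le> ln (F y) + g1 * r y / Z / F y - 1"
        using ry Fy g1 Z by (intro ln_le_tangent) auto
      moreover have "ln (g1 / S) \<le> ln (r y) + g1 / S / r y - 1"
        using ry Fy g1 S by (intro ln_le_tangent) auto
      ultimately have "L - ln (F y) \<le> g1 * r y / Z / F y + g1 / S / r y - 2"
        using ry g1 Z S by (simp add: L_def ln_div ln_mult)
      then have "r y * F y * (L - ln (F y)) \<le> r y * F y * (g1 * r y / Z / F y + g1 / S / r y - 2)"
        using ry Fy by (intro mult_left_mono) auto
      also have "\<dots> = g1 / Z * (r y)\<^sup>2 + g1 / S * F y - 2 * (r y * F y)"
        using ry Fy Z S by (simp add: field_simps power2_eq_square)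
      finally show ?thesis by (simp add: algebra_simps)
    qed
  qed (use int in simp_all)
  also have "\<dots> = g1 / S * g2 - g1"
    using int Z by (simp add: Z_def[symmetric] e1[symmetric] g2_def[symmetric])
  finally have "g1 * (ln g1 - ln S + 1 - g2 / S - ln Z) \<le> ent \<rho>1 F"
    unfolding ent_def g1_def[symmetric] L_def by (simp add: algebra_simps)
  then have "ln g1 - ln S + 1 - g2 / S - ln Z \<le> ent \<rho>1 F / g1"
    using g1 by (simp add: pos_le_divide_eq mult.commute)
  then have "ln (g1 / S) + 1 - g2 / S - ent \<rho>1 F / g1 \<le> ln Z"
    using g1 S by (simp add: ln_div)
  then have "exp (ln (g1 / S) + 1 - g2 / S - ent \<rho>1 F / g1) \<le> exp (ln Z)" by simp
  also have "\<dots> = Z" using Z by simp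
  finally have "exp (ln (g1 / S) + 1 - g2 / S - ent \<rho>1 F / g1) \<le> Z" .
  then show ?thesis unfolding r(7) g1_def[symmetric] g2_def[symmetric] Z_def[symmetric] by (intro ennreal_leI)
qed (simp add: not_less top_unique)

section \<open>Variance and entropy under a mixture\<close>

locale mixture = prob_space \<mu> for \<mu> :: "'x measure" +
  fixes P :: "'x \<Rightarrow> 'y measure" and N :: "'y measure"
  assumes kernel: "P \<in> \<mu> \<rightarrow>\<^sub>M prob_algebra N"
begin

sublocale pair: pair_prob_space \<mu> \<mu> ..

lemma kernel_subprob[measurable]: "P \<in> \<mu> \<rightarrow>\<^sub>M subprob_algebra N"
  using kernel by (rule measurable_prob_algebraD)

lemma kernel_prob: "x \<in> space \<mu> \<Longrightarrow> prob_space (P x)"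
  and kernel_sets: "x \<in> space \<mu> \<Longrightarrow> sets (P x) = sets N"
  using measurable_space[OF kernel] by (auto simp: space_prob_algebra)

lemma kernel_space: "x \<in> space \<mu> \<Longrightarrow> space (P x) = space N"
  using kernel_sets sets_eq_imp_space_eq by blast

lemma bmeas_kernel: "x \<in> space \<mu> \<Longrightarrow> bmeas (P x) = bmeas N"
  by (rule bmeas_cong_sets[OF kernel_sets])

lemma sets_mixture: "sets (\<mu> \<bind> P) = sets N"
  using kernel_subprob not_empty by (intro sets_bind[OF kernel_sets]) auto

lemma prob_space_mixture: "prob_space (\<mu> \<bind> P)"
  by (rule prob_space_bind[OF AE_I2[OF kernel_prob] kernel_subprob])

lemma bmeas_mixture: "bmeas (\<mu> \<bind> P) = bmeas N"
  by (rule bmeas_cong_sets[OF sets_mixture])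

lemma kernel_mean_abs_le:
  assumes "f \<in> bmeas N" "x \<in> space \<mu>" "\<And>y. y \<in> space N \<Longrightarrow> \<bar>f y\<bar> \<le> B"
  shows "\<bar>\<integral>y. f y \<partial>P x\<bar> \<le> B"
proof -
  interpret Px: prob_space "P x" by (rule kernel_prob[OF assms(2)])
  have f: "f \<in> bmeas (P x)" using assms by (simp add: bmeas_kernel)
  have "\<bar>\<integral>y. f y \<partial>P x\<bar> \<le> (\<integral>y. \<bar>f y\<bar> \<partial>P x)" by (rule integral_abs_bound)
  also have "\<dots> \<le> (\<integral>y. B \<partial>P x)"
    using assms(2,3) f by (intro integral_mono Px.bmeas_integrable bmeas_intros) (auto simp: kernel_space)
  finally show ?thesis by (simp add: Px.prob_space)
qed

lemma bmeas_kernel_mean: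
  assumes "f \<in> bmeas N"
  shows "(\<lambda>x. \<integral>y. f y \<partial>P x) \<in> bmeas \<mu>"
proof -
  obtain B where B: "\<forall>y\<in>space N. \<bar>f y\<bar> \<le> B" using bmeas_bounded[OF assms] by blast
  show ?thesis
  proof (rule bmeasI)
    show "(\<lambda>x. \<integral>y. f y \<partial>P x) \<in> borel_measurable \<mu>"
      by (rule measurable_compose[OF kernel_subprob integral_measurable_subprob_algebra[OF bmeas_measurable[OF assms]]])
    show "\<bar>\<integral>y. f y \<partial>P x\<bar> \<le> B" if "x \<in> space \<mu>" for x
      using kernel_mean_abs_le[OF assms that] B by blast
  qed
qed

lemma mixture_integral:
  assumes "f \<in> bmeas N"
  shows "(\<integral>y. f y \<partial>(\<mu> \<bind> P)) = (\<integral>x. \<integral>y. f y \<partial>P x \<partial>\<mu>)"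
proof -
  obtain B where B: "\<forall>y\<in>space N. \<bar>f y\<bar> \<le> B" using bmeas_bounded[OF assms] by blast
  show ?thesis
  proof (rule integral_bind[OF bmeas_measurable[OF assms] _ kernel_subprob finite_measure_axioms])
    show "AE x in \<mu>. emeasure (P x) (space (P x)) \<le> ennreal 1"
      by (intro AE_I2) (simp add: prob_space.emeasure_space_1[OF kernel_prob])
  qed (use B in blast)
qed

lemma bmeas_fst: "f \<in> bmeas \<mu> \<Longrightarrow> (\<lambda>z. f (fst z)) \<in> bmeas (\<mu> \<Otimes>\<^sub>M \<mu>)"
  and bmeas_snd: "f \<in> bmeas \<mu> \<Longrightarrow> (\<lambda>z. f (snd z)) \<in> bmeas (\<mu> \<Otimes>\<^sub>M \<mu>)"
  unfolding bmeas_def by (auto simp: space_pair_measure)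

lemma pair_integral:
  assumes "h \<in> bmeas (\<mu> \<Otimes>\<^sub>M \<mu>)"
  shows "(\<integral>z. h z \<partial>(\<mu> \<Otimes>\<^sub>M \<mu>)) = (\<integral>x. \<integral>x'. h (x, x') \<partial>\<mu> \<partial>\<mu>)"
  by (rule pair.integral_fst'[symmetric]) (rule pair.bmeas_integrable[OF assms])

text \<open>
  The integral that defines \<open>K_chi2\<close> is monotone without measurability of its integrand, so any
  measurable minorant of \<open>1 + chi2\<close> inherits the moment bound.
\<close>
lemma K_chi2_minorant:
  assumes p: "1 < p" and K: "K_chi2 p P \<mu> = ennreal K" "0 \<le> K"
    and h: "h \<in> bmeas (\<mu> \<Otimes>\<^sub>M \<mu>)" "\<And>z. 0 \<le> h z"
    and le: "\<And>x x'. x \<in> space \<mu> \<Longrightarrow> x' \<in> space \<mu> \<Longrightarrow> ennreal (h (x, x')) \<le> 1 + chi2 (P x) (P x')"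
  shows "integrable (\<mu> \<Otimes>\<^sub>M \<mu>) (\<lambda>z. h z powr p)" "(\<integral>z. h z powr p \<partial>(\<mu> \<Otimes>\<^sub>M \<mu>)) \<le> K powr p"
proof -
  define I where "I = (\<integral>\<^sup>+ (x, x'). ennpowr (1 + chi2 (P x) (P x')) p \<partial>(\<mu> \<Otimes>\<^sub>M \<mu>))"
  have KI: "ennpowr I (1 / p) = ennreal K" using K(1) unfolding K_chi2_def I_def .
  then have I: "I \<noteq> \<infinity>" by (auto simp: ennpowr_def)
  then have "enn2real I powr (1 / p) = K" using KI K(2) by (simp add: ennpowr_def)
  then have "enn2real I = K powr p" using p by (auto simp: powr_powr)
  then have IK: "I = ennreal (K powr p)" using I ennreal_enn2real_if[of I] by simp
  obtain B where B: "0 \<le> B" "\<forall>z\<in>space (\<mu> \<Otimes>\<^sub>M \<mu>). \<bar>h z\<bar> \<le> B" using bmeas_bounded[OF h(1)] by blast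
  have "(\<lambda>z. h z powr p) \<in> bmeas (\<mu> \<Otimes>\<^sub>M \<mu>)"
  proof (rule bmeasI)
    show "(\<lambda>z. h z powr p) \<in> borel_measurable (\<mu> \<Otimes>\<^sub>M \<mu>)" using bmeas_measurable[OF h(1)] by simp
    show "\<bar>h z powr p\<bar> \<le> B powr p" if "z \<in> space (\<mu> \<Otimes>\<^sub>M \<mu>)" for z
      using B that h(2)[of z] p by (auto intro!: powr_mono2)
  qed
  then show int: "integrable (\<mu> \<Otimes>\<^sub>M \<mu>) (\<lambda>z. h z powr p)" by (rule pair.bmeas_integrable)
  have "ennreal (\<integral>z. h z powr p \<partial>(\<mu> \<Otimes>\<^sub>M \<mu>)) = (\<integral>\<^sup>+ z. ennreal (h z powr p) \<partial>(\<mu> \<Otimes>\<^sub>M \<mu>))"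
    by (rule nn_integral_eq_integral[OF int, symmetric]) simp
  also have "\<dots> \<le> I" unfolding I_def
  proof (rule nn_integral_mono)
    fix z assume z: "z \<in> space (\<mu> \<Otimes>\<^sub>M \<mu>)"
    obtain x x' where zx: "z = (x, x')" "x \<in> space \<mu>" "x' \<in> space \<mu>"
      using z by (auto simp: space_pair_measure)
    show "ennreal (h z powr p) \<le> (case z of (x, x') \<Rightarrow> ennpowr (1 + chi2 (P x) (P x')) p)"
    proof (cases "1 + chi2 (P x) (P x') = \<infinity>")
      case False
      define c where "c = enn2real (1 + chi2 (P x) (P x'))"
      have c: "1 + chi2 (P x) (P x') = ennreal c"
        using False ennreal_enn2real_if[of "1 + chi2 (P x) (P x')"] by (simp add: c_def)
      have "h z \<le> c" using le[OF zx(2,3)] h(2)[of z] unfolding c zx(1)[symmetric]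
        by (simp add: ennreal_le_iff2) (auto simp: c_def)
      then show ?thesis using h(2)[of z] p False unfolding zx(1) 
        by (simp add: ennpowr_def c_def[symmetric] powr_mono2)
    qed (simp add: zx(1) ennpowr_def)
  qed
  finally show "(\<integral>z. h z powr p \<partial>(\<mu> \<Otimes>\<^sub>M \<mu>)) \<le> K powr p"
    unfolding IK by simp
qed

text \<open>
  The \<open>L\<^sup>1\<close>-norm is at most the \<open>L\<^sup>p\<close>-norm: apply Young's inequality pointwise to
  \<open>h * K powr (p - 1)\<close>. The minorant may be negative here and is truncated at \<open>0\<close> first.
\<close>
lemma K_chi2_minorant_mean:
  assumes p: "1 < p" and K: "K_chi2 p P \<mu> = ennreal K" "0 < K"
    and h: "h \<in> bmeas (\<mu> \<Otimes>\<^sub>M \<mu>)"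
    and le: "\<And>x x'. x \<in> space \<mu> \<Longrightarrow> x' \<in> space \<mu> \<Longrightarrow> ennreal (h (x, x')) \<le> 1 + chi2 (P x) (P x')"
  shows "(\<integral>z. h z \<partial>(\<mu> \<Otimes>\<^sub>M \<mu>)) \<le> K"
proof -
  define q where "q = p / (p - 1)"
  define h' where "h' = (\<lambda>z. max 0 (h z))"
  obtain B where "0 \<le> B" "\<forall>z\<in>space (\<mu> \<Otimes>\<^sub>M \<mu>). \<bar>h z\<bar> \<le> B" using bmeas_bounded[OF h] by blast
  then have h': "h' \<in> bmeas (\<mu> \<Otimes>\<^sub>M \<mu>)"
    unfolding h'_def using bmeas_measurable[OF h] by (intro bmeasI[of _ _ B]) (auto simp: abs_le_iff)
  have h'0: "0 \<le> h' z" for z by (simp add: h'_def)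
  have le': "ennreal (h' (x, x')) \<le> 1 + chi2 (P x) (P x')" if "x \<in> space \<mu>" "x' \<in> space \<mu>" for x x'
    using le[OF that] by (auto simp: h'_def max_def)
  note m = K_chi2_minorant[OF p K(1) less_imp_le[OF K(2)] h' h'0 le']
  define c where "c = K powr (1 - p) / p"
  have pq: "1 < q" "1 / p + 1 / q = 1" using p by (auto simp: q_def field_simps)
  have "h z \<le> c * h' z powr p + K / q" for z
  proof -
    have "h' z * K powr (p - 1) \<le> h' z powr p / p + (K powr (p - 1)) powr q / q"
      using Youngs_inequality[OF p pq h'0[of z], of "K powr (p - 1)"] by simp
    also have "(K powr (p - 1)) powr q = K powr p"
      using p by (simp add: powr_powr q_def)
    finally have "h' z * K powr (p - 1) * K powr (1 - p) \<le> (h' z powr p / p + K powr p / q) * K powr (1 - p)"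
      by (rule mult_right_mono) simp
    moreover have "K powr (p - 1) * K powr (1 - p) = 1" "K powr p * K powr (1 - p) = K"
      using K(2) by (simp_all flip: powr_add)
    ultimately have "h' z \<le> c * h' z powr p + K / q"
      by (simp add: c_def mult.assoc distrib_right) (simp add: algebra_simps)
    then show ?thesis by (simp add: h'_def)
  qed
  then have "(\<integral>z. h z \<partial>(\<mu> \<Otimes>\<^sub>M \<mu>)) \<le> (\<integral>z. c * h' z powr p + K / q \<partial>(\<mu> \<Otimes>\<^sub>M \<mu>))"
    using m(1) by (intro integral_mono pair.bmeas_integrable[OF h]) auto
  also have "\<dots> = c * (\<integral>z. h' z powr p \<partial>(\<mu> \<Otimes>\<^sub>M \<mu>)) + K / q"
    using m(1) by (simp add: pair.prob_space)
  also have "\<dots> \<le> c * K powr p + K / q"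
    using m(2) p by (intro add_right_mono mult_left_mono) (auto simp: c_def)
  also have "c * K powr p = K / p" unfolding c_def using K(2) by (simp add: flip: powr_add)
  also have "K / p + K / q = K * (1 / p + 1 / q)" by (simp add: algebra_simps)
  finally show ?thesis unfolding pq(2) by simp
qed

lemma bmeas_kernel_variance:
  assumes f: "f \<in> bmeas N"
  shows "(\<lambda>x. prob_space.variance (P x) f) \<in> bmeas \<mu>"
proof -
  have eq: "prob_space.variance (P x) f = (\<integral>y. (f y)\<^sup>2 \<partial>P x) - (\<integral>y. f y \<partial>P x)\<^sup>2" if x: "x \<in> space \<mu>" for x
  proof -
    interpret Px: prob_space "P x" by (rule kernel_prob[OF x])
    have fx: "f \<in> bmeas (P x)" using f x by (simp add: bmeas_kernel)
    show ?thesis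
      by (intro Px.variance_eq Px.bmeas_integrable fx bmeas_power)
  qed
  have "(\<lambda>x. (\<integral>y. (f y)\<^sup>2 \<partial>P x) - (\<integral>y. f y \<partial>P x)\<^sup>2) \<in> bmeas \<mu>"
    by (intro bmeas_diff bmeas_kernel_mean bmeas_power f)
  then show ?thesis unfolding bmeas_def by (simp add: eq cong: measurable_cong)
qed

text \<open>
  Let \<open>V x\<close> be the variance under \<open>P x\<close>, \<open>EV\<close> its mean, \<open>m\<close> the mean of \<open>G\<close> and \<open>v\<close> its variance. The
  test function \<open>1 + \<beta> * (G x - m) * (f - G x')\<close> in \<open>chi2_variational\<close> gives a minorant of \<open>1 + chi2\<close> whose mean is
  \<open>1 + 2 * \<beta> * v - \<beta>\<^sup>2 * v * EV\<close>: the factor \<open>V x'\<close> is multiplied by a function of \<open>x\<close> alone, so the mean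
  factorises. The choice \<open>\<beta> = 1 / EV\<close> yields \<open>v \<le> (K - 1) * EV\<close>.
\<close>
lemma mixture_variance_le:
  assumes p: "1 < p" and K: "K_chi2 p P \<mu> = ennreal K" "0 < K" and f: "f \<in> bmeas N"
  shows "prob_space.variance (\<mu> \<bind> P) f \<le> K * (\<integral>x. prob_space.variance (P x) f \<partial>\<mu>)"
proof -
  define G where "G = (\<lambda>x. \<integral>y. f y \<partial>P x)"
  define m where "m = (\<integral>y. f y \<partial>(\<mu> \<bind> P))"
  define V where "V = (\<lambda>x. \<integral>y. (f y - G x)\<^sup>2 \<partial>P x)"
  have G: "G \<in> bmeas \<mu>" unfolding G_def by (rule bmeas_kernel_mean[OF f])
  have m: "m = (\<integral>x. G x \<partial>\<mu>)" unfolding m_def G_def by (rule mixture_integral[OF f])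
  have affine: "(\<integral>y. a + b * (f y - c) \<partial>P x) = a + b * (G x - c)"
    and square: "(\<integral>y. (a + b * (f y - c))\<^sup>2 \<partial>P x) = b\<^sup>2 * V x + (a + b * (G x - c))\<^sup>2"
    if x: "x \<in> space \<mu>" for x a b c
  proof -
    interpret Px: prob_space "P x" by (rule kernel_prob[OF x])
    have fx: "f \<in> bmeas (P x)" using f x by (simp add: bmeas_kernel)
    have f2x: "(\<lambda>y. (f y - G x)\<^sup>2) \<in> bmeas (P x)" by (intro bmeas_intros fx)
    note int = Px.bmeas_integrable[OF fx] Px.bmeas_integrable[OF f2x]
    show "(\<integral>y. a + b * (f y - c) \<partial>P x) = a + b * (G x - c)"
      using int by (simp add: Px.prob_space G_def)
    have "(a + b * (f y - c))\<^sup>2 = b\<^sup>2 * (f y - G x)\<^sup>2 + (2 * b * (a + b * (G x - c)) * (f y - G x) + (a + b * (G x - c))\<^sup>2)" for y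
      by (simp add: power2_eq_square algebra_simps)
    then have "(\<integral>y. (a + b * (f y - c))\<^sup>2 \<partial>P x)
        = b\<^sup>2 * V x + 2 * b * (a + b * (G x - c)) * (\<integral>y. f y - G x \<partial>P x) + (a + b * (G x - c))\<^sup>2"
      using int by (simp add: Px.prob_space V_def)
    moreover have "(\<integral>y. f y - G x \<partial>P x) = 0" using int by (simp add: Px.prob_space G_def)
    ultimately show "(\<integral>y. (a + b * (f y - c))\<^sup>2 \<partial>P x) = b\<^sup>2 * V x + (a + b * (G x - c))\<^sup>2" by simp
  qed
  have V: "V \<in> bmeas \<mu>" unfolding V_def G_def by (rule bmeas_kernel_variance[OF f])
  define EV where "EV = (\<integral>x. V x \<partial>\<mu>)"
  define v where "v = (\<integral>x. (G x - m)\<^sup>2 \<partial>\<mu>)"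
  have EV: "0 \<le> EV" unfolding EV_def V_def by simp
  have v: "0 \<le> v" unfolding v_def by simp
  have total: "prob_space.variance (\<mu> \<bind> P) f = EV + v"
  proof -
    have "prob_space.variance (\<mu> \<bind> P) f = (\<integral>y. (f y - m)\<^sup>2 \<partial>(\<mu> \<bind> P))"
      by (simp add: m_def)
    also have "\<dots> = (\<integral>x. \<integral>y. (f y - m)\<^sup>2 \<partial>P x \<partial>\<mu>)"
      by (intro mixture_integral bmeas_intros f)
    also have "\<dots> = (\<integral>x. V x + (G x - m)\<^sup>2 \<partial>\<mu>)"
      using square[of _ 0 1 m] by (intro Bochner_Integration.integral_cong) auto
    also have "\<dots> = EV + v"
      unfolding EV_def v_def
      by (intro Bochner_Integration.integral_add bmeas_integrable bmeas_intros V G)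
    finally show ?thesis .
  qed
  have key: "1 + 2 * \<beta> * v - \<beta>\<^sup>2 * v * EV \<le> K" for \<beta>
  proof -
    define h where "h = (\<lambda>z. 1 + 2 * \<beta> * (G (fst z) - m) * (G (fst z) - G (snd z))
        - \<beta>\<^sup>2 * (G (fst z) - m)\<^sup>2 * V (snd z))"
    have h: "h \<in> bmeas (\<mu> \<Otimes>\<^sub>M \<mu>)"
      unfolding h_def by (intro bmeas_intros bmeas_fst bmeas_snd G V)
    have "(\<integral>z. h z \<partial>(\<mu> \<Otimes>\<^sub>M \<mu>)) \<le> K"
    proof (rule K_chi2_minorant_mean[OF p K h])
      fix x x' assume x: "x \<in> space \<mu>" "x' \<in> space \<mu>"
      define b where "b = \<beta> * (G x - m)"
      have "ennreal (2 * (\<integral>y. 1 + b * (f y - G x') \<partial>P x) - (\<integral>y. (1 + b * (f y - G x'))\<^sup>2 \<partial>P x'))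
          \<le> 1 + chi2 (P x) (P x')"
        using x f by (intro chi2_variational kernel_prob bmeas_intros) (auto simp: kernel_sets bmeas_kernel)
      also have "2 * (\<integral>y. 1 + b * (f y - G x') \<partial>P x) - (\<integral>y. (1 + b * (f y - G x'))\<^sup>2 \<partial>P x') = h (x, x')"
        unfolding affine[OF x(1)] square[OF x(2)] by (simp add: h_def b_def power2_eq_square algebra_simps)
      finally show "ennreal (h (x, x')) \<le> 1 + chi2 (P x) (P x')" .
    qed
    also have "(\<integral>z. h z \<partial>(\<mu> \<Otimes>\<^sub>M \<mu>)) = (\<integral>x. \<integral>x'. h (x, x') \<partial>\<mu> \<partial>\<mu>)" by (rule pair_integral[OF h])
    also have "\<dots> = (\<integral>x. 1 + 2 * \<beta> * (G x - m)\<^sup>2 - \<beta>\<^sup>2 * EV * (G x - m)\<^sup>2 \<partial>\<mu>)"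
    proof (rule Bochner_Integration.integral_cong[OF refl])
      fix x
      show "(\<integral>x'. h (x, x') \<partial>\<mu>) = 1 + 2 * \<beta> * (G x - m)\<^sup>2 - \<beta>\<^sup>2 * EV * (G x - m)\<^sup>2"
        using bmeas_integrable[OF G] bmeas_integrable[OF V]
        by (simp add: h_def prob_space m[symmetric] EV_def[symmetric] power2_eq_square)
    qed
    also have "\<dots> = 1 + 2 * \<beta> * v - \<beta>\<^sup>2 * EV * v"
    proof -
      have "(\<lambda>x. (G x - m)\<^sup>2) \<in> bmeas \<mu>" by (intro bmeas_intros G)
      then show ?thesis using bmeas_integrable by (simp add: prob_space v_def)
    qed
    finally show ?thesis by (simp add: mult_ac)
  qed
  have "v \<le> (K - 1) * EV"
  proof (cases "EV = 0")
    case True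
    have "v = 0"
    proof (rule ccontr)
      assume "v \<noteq> 0"
      \<comment> \<open>For \<open>EV = 0\<close> the bound in \<open>key\<close> is linear in \<open>\<beta>\<close>; this \<open>\<beta>\<close> makes it read \<open>1 + 2 * K \<le> K\<close>.\<close>
      with key[of "K / v"] True K(2) show False by simp
    qed
    with True show ?thesis by simp
  next
    case False
    with EV have "0 < EV" by simp
    then have "1 + v / EV \<le> K" using key[of "1 / EV"] by (simp add: power2_eq_square)
    then have "v / EV \<le> K - 1" by simp
    then show ?thesis using \<open>0 < EV\<close> by (simp add: pos_divide_le_eq)
  qed
  then have "EV + v \<le> K * EV" by (simp add: algebra_simps)
  then show ?thesis unfolding total EV_def V_def G_def .
qed

lemma bmeas_kernel_ent:
  assumes "F \<in> bmeas N" "\<And>y. y \<in> space N \<Longrightarrow> 0 \<le> F y"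
  shows "(\<lambda>x. ent (P x) F) \<in> bmeas \<mu>"
proof -
  have pos: "0 \<le> (\<integral>y. F y \<partial>P x)" if "x \<in> space \<mu>" for x
    using assms(2) kernel_space[OF that] by (intro Bochner_Integration.integral_nonneg) auto
  show ?thesis unfolding ent_def
    by (intro bmeas_diff bmeas_kernel_mean bmeas_mult_ln assms pos)
qed

text \<open>
  Let \<open>g\<close>, \<open>e\<close> be the mean and the entropy of \<open>F\<close> under \<open>P x\<close>, \<open>D\<close> the entropy of \<open>g\<close> and \<open>E\<close> the mean of \<open>e\<close>, so
  that the left-hand side is \<open>E + D\<close>. The minorant \<open>T\<close> of \<open>1 + chi2\<close> comes from \<open>chi2_entropic\<close> with \<open>S\<close> the
  overall mean of \<open>F\<close>, and \<open>g * ln T\<close> has mean \<open>D - E\<close>. Comparing \<open>p * ln T\<close> with its tangent at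
  \<open>g * K powr p / S\<close> bounds the same mean by \<open>(D + p * ln K * S) / p\<close>, and solving for \<open>D\<close> gives the factor \<open>q\<close>.
\<close>
lemma mixture_ent_le:
  assumes p: "1 < p" and K: "K_chi2 p P \<mu> = ennreal K" "0 < K"
    and F: "F \<in> bmeas N" "\<And>y. y \<in> space N \<Longrightarrow> 0 \<le> F y"
  defines "q \<equiv> p / (p - 1)"
  shows "ent (\<mu> \<bind> P) F \<le> (1 + q) * (\<integral>x. ent (P x) F \<partial>\<mu>) + q * ln K * (\<integral>y. F y \<partial>(\<mu> \<bind> P))"
proof -
  interpret M: prob_space "\<mu> \<bind> P" by (rule prob_space_mixture)
  have q: "0 < q" using p by (simp add: q_def)
  have FM: "F \<in> bmeas (\<mu> \<bind> P)" "\<And>y. y \<in> space (\<mu> \<bind> P) \<Longrightarrow> 0 \<le> F y"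
    using F sets_eq_imp_space_eq[OF sets_mixture] by (auto simp: bmeas_mixture)
  have FlnF: "(\<lambda>y. F y * ln (F y)) \<in> bmeas N" by (rule bmeas_mult_ln[OF F])
  define S where "S = (\<integral>y. F y \<partial>(\<mu> \<bind> P))"
  define g where "g = (\<lambda>x. \<integral>y. F y \<partial>P x)"
  define e where "e = (\<lambda>x. ent (P x) F)"
  define E where "E = (\<integral>x. e x \<partial>\<mu>)"
  have g: "g \<in> bmeas \<mu>" unfolding g_def by (rule bmeas_kernel_mean[OF F(1)])
  have e: "e \<in> bmeas \<mu>" unfolding e_def by (rule bmeas_kernel_ent[OF F])
  have g0: "0 \<le> g x" if "x \<in> space \<mu>" for x
    unfolding g_def using F(2) kernel_space[OF that] by (intro Bochner_Integration.integral_nonneg) auto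
  have FP: "F \<in> bmeas (P x)" "\<And>y. y \<in> space (P x) \<Longrightarrow> 0 \<le> F y" if "x \<in> space \<mu>" for x
    using F bmeas_kernel[OF that] kernel_space[OF that] by auto
  have e0: "0 \<le> e x" if "x \<in> space \<mu>" for x
    unfolding e_def by (rule prob_space.ent_nonneg[OF kernel_prob[OF that] FP[OF that]])
  have S: "S = (\<integral>x. g x \<partial>\<mu>)" unfolding S_def g_def by (rule mixture_integral[OF F(1)])
  have S0: "0 \<le> S" unfolding S_def using FM by (intro Bochner_Integration.integral_nonneg)
  have E0: "0 \<le> E" unfolding E_def by (intro Bochner_Integration.integral_nonneg e0)
  have glng: "(\<lambda>x. g x * ln (g x)) \<in> bmeas \<mu>" by (rule bmeas_mult_ln[OF g g0])
  define b where "b = (\<integral>x. g x * ln (g x) \<partial>\<mu>)"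
  have total: "ent (\<mu> \<bind> P) F = E + b - S * ln S"
  proof -
    have "(\<integral>y. F y * ln (F y) \<partial>(\<mu> \<bind> P)) = (\<integral>x. \<integral>y. F y * ln (F y) \<partial>P x \<partial>\<mu>)"
      by (rule mixture_integral[OF FlnF])
    also have "\<dots> = (\<integral>x. e x + g x * ln (g x) \<partial>\<mu>)" by (simp add: e_def ent_def g_def)
    also have "\<dots> = E + b" unfolding E_def b_def
      by (intro Bochner_Integration.integral_add bmeas_integrable e glng)
    finally show ?thesis unfolding ent_def S_def by simp
  qed
  show ?thesis
  proof (cases "S = 0")
    case True
    have "AE x in \<mu>. g x = 0"
      using True S by (intro bmeas_integral_eq_0 g g0) auto
    then have "AE x in \<mu>. g x * ln (g x) = 0" by eventually_elim simp
    then have "b = 0" unfolding b_def by (rule integral_eq_zero_AE)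
    then have "ent (\<mu> \<bind> P) F = E" using total True by simp
    also have "\<dots> \<le> (1 + q) * E" using q E0 by (simp add: algebra_simps)
    finally show ?thesis using True unfolding S_def[symmetric] E_def e_def by simp
  next
    case False
    then have Spos: "0 < S" using S0 by simp
    define T where "T = (\<lambda>z. if 0 < g (fst z)
      then exp (ln (g (fst z) / S) + 1 - g (snd z) / S - e (fst z) / g (fst z)) else 0)"
    have T0: "0 \<le> T z" for z by (simp add: T_def)
    have T: "T \<in> bmeas (\<mu> \<Otimes>\<^sub>M \<mu>)"
    proof -
      obtain B where B: "0 \<le> B" "\<forall>x\<in>space \<mu>. \<bar>g x\<bar> \<le> B" using bmeas_bounded[OF g] by blast
      note [measurable] = bmeas_measurable[OF g] bmeas_measurable[OF e]
      show ?thesis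
      proof (rule bmeasI)
        show "T \<in> borel_measurable (\<mu> \<Otimes>\<^sub>M \<mu>)" unfolding T_def by measurable
        fix z assume "z \<in> space (\<mu> \<Otimes>\<^sub>M \<mu>)"
        then have z: "fst z \<in> space \<mu>" "snd z \<in> space \<mu>" by (auto simp: space_pair_measure)
        show "\<bar>T z\<bar> \<le> B / S * exp 1"
        proof (cases "0 < g (fst z)")
          case True
          have "0 \<le> g (snd z) / S" "0 \<le> e (fst z) / g (fst z)"
            using g0[OF z(2)] e0[OF z(1)] True Spos by simp_all
          then have "T z \<le> exp (ln (g (fst z) / S) + 1)" using True by (simp add: T_def)
          also have "\<dots> = g (fst z) / S * exp 1" using True Spos by (simp add: exp_add)
          also have "\<dots> \<le> B / S * exp 1"
            using B(2) z(1) Spos by (intro mult_right_mono divide_right_mono) (auto simp: abs_le_iff)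
          finally show ?thesis using T0[of z] by simp
        next
          case False
          then show ?thesis using B(1) Spos by (simp add: T_def)
        qed
      qed
    qed
    have T_le: "ennreal (T (x, x')) \<le> 1 + chi2 (P x) (P x')" if x: "x \<in> space \<mu>" "x' \<in> space \<mu>" for x x'
    proof (cases "0 < g x")
      case True
      then show ?thesis
        using chi2_entropic[OF kernel_prob[OF x(1)] kernel_prob[OF x(2)] _ FP[OF x(2)] _ Spos]
        using kernel_sets x by (simp add: T_def g_def e_def)
    qed (simp add: T_def)
    note m = K_chi2_minorant[OF p K(1) less_imp_le[OF K(2)] T T0 T_le]
    define c where "c = S / K powr p"
    \<comment> \<open>\<open>l\<close> is \<open>g * ln T\<close> written without logarithms of \<open>T\<close>, so that it is bounded also where \<open>g\<close>
      vanishes; \<open>w\<close> collects the bounded terms of the tangent bound.\<close>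
    define l where "l = (\<lambda>z. g (fst z) * ln (g (fst z)) - g (fst z) * ln S - g (fst z) * g (snd z) / S + g (fst z) - e (fst z))"
    define w where "w = (\<lambda>z :: 'x \<times> 'x. g (fst z) * ln (g (fst z)) + (p * ln K - ln S - 1) * g (fst z))"
    have "l \<in> bmeas (\<mu> \<Otimes>\<^sub>M \<mu>)" "w \<in> bmeas (\<mu> \<Otimes>\<^sub>M \<mu>)"
      unfolding l_def w_def
      by (intro bmeas_diff bmeas_add bmeas_divide bmeas_fst[OF glng] bmeas_mult bmeas_const
          bmeas_fst[OF g] bmeas_snd[OF g] bmeas_fst[OF e])+
    note lw = this
    have pt: "l z \<le> (w z + c * T z powr p) / p" if z: "z \<in> space (\<mu> \<Otimes>\<^sub>M \<mu>)" for z
    proof -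
      have zs: "fst z \<in> space \<mu>" using z by (auto simp: space_pair_measure)
      show ?thesis
      proof (cases "0 < g (fst z)")
        case True
        define u where "u = g (fst z)"
        have u: "0 < u" using True by (simp add: u_def)
        define L where "L = ln (u / S) + 1 - g (snd z) / S - e (fst z) / u"
        have TL: "T z = exp L" using True by (simp add: T_def L_def u_def)
        have "ln (T z powr p) \<le> ln (u * K powr p / S) + T z powr p / (u * K powr p / S) - 1"
          using u Spos K(2) TL by (intro ln_le_tangent) auto
        then have "p * L \<le> ln u + p * ln K - ln S + T z powr p * c / u - 1"
          using u Spos K(2) p by (simp add: TL ln_powr ln_div ln_mult c_def field_simps)
        then have "u * (p * L) \<le> u * (ln u + p * ln K - ln S + T z powr p * c / u - 1)"
          using u by (intro mult_left_mono) auto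
        also have "\<dots> = w z + c * T z powr p"
          using u by (simp add: w_def u_def[symmetric] algebra_simps)
        finally have "p * (u * L) \<le> w z + c * T z powr p" by (simp add: mult_ac)
        moreover have "u * L = l z"
          using u Spos by (simp add: L_def l_def u_def[symmetric] ln_div algebra_simps)
        ultimately show ?thesis using p by (simp add: pos_le_divide_eq mult.commute)
      next
        case False
        then have "g (fst z) = 0" using g0[OF zs] by simp
        then show ?thesis using e0[OF zs] p Spos T0[of z] by (simp add: l_def w_def T_def)
      qed
    qed
    have "(\<integral>z. l z \<partial>(\<mu> \<Otimes>\<^sub>M \<mu>)) \<le> (\<integral>z. (w z + c * T z powr p) / p \<partial>(\<mu> \<Otimes>\<^sub>M \<mu>))"
      using m(1) pair.bmeas_integrable[OF lw(2)] by (intro integral_mono pair.bmeas_integrable[OF lw(1)] pt) auto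
    also have "\<dots> = ((\<integral>z. w z \<partial>(\<mu> \<Otimes>\<^sub>M \<mu>)) + c * (\<integral>z. T z powr p \<partial>(\<mu> \<Otimes>\<^sub>M \<mu>))) / p"
      using m(1) pair.bmeas_integrable[OF lw(2)] by simp
    also have "\<dots> \<le> ((\<integral>z. w z \<partial>(\<mu> \<Otimes>\<^sub>M \<mu>)) + c * K powr p) / p"
      using m(2) p Spos by (intro divide_right_mono add_left_mono mult_left_mono) (auto simp: c_def)
    also have "c * K powr p = S" using K(2) by (simp add: c_def)
    also have "(\<integral>z. w z \<partial>(\<mu> \<Otimes>\<^sub>M \<mu>)) = b + (p * ln K - ln S - 1) * S"
      unfolding pair_integral[OF lw(2)]
      using bmeas_integrable[OF glng] bmeas_integrable[OF g] by (simp add: w_def prob_space b_def S)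
    also have "(\<integral>z. l z \<partial>(\<mu> \<Otimes>\<^sub>M \<mu>)) = b - S * ln S - E"
    proof -
      have "(\<integral>x'. l (x, x') \<partial>\<mu>) = g x * ln (g x) - g x * ln S - e x" for x
        using bmeas_integrable[OF g] Spos by (simp add: l_def prob_space S[symmetric])
      then show ?thesis
        unfolding pair_integral[OF lw(1)]
        using bmeas_integrable[OF glng] bmeas_integrable[OF g] bmeas_integrable[OF e]
        by (simp add: b_def S[symmetric] E_def)
    qed
    finally have "b - S * ln S - E \<le> (b - S * ln S + p * ln K * S) / p"
      by (simp add: algebra_simps)
    define D where "D = b - S * ln S"
    have "D - E \<le> (D + p * ln K * S) / p" unfolding D_def by fact
    then have "(D - E) * p \<le> D + p * ln K * S" using p by (simp add: pos_le_divide_eq)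
    then have "D * (p - 1) \<le> p * (E + ln K * S)" by (simp add: algebra_simps)
    then have "D \<le> p * (E + ln K * S) / (p - 1)" using p by (simp add: pos_le_divide_eq)
    also have "\<dots> = q * (E + ln K * S)" by (simp add: q_def)
    finally have "E + D \<le> (1 + q) * E + q * ln K * S" by (simp add: algebra_simps)
    then show ?thesis unfolding total D_def S_def[symmetric] E_def e_def by simp
  qed
qed

end

section \<open>Gradient forms and optimal constants\<close>

context gradient_form
begin

lemma in_bmeas:
  assumes "f \<in> A" "sets \<rho> = sets borel"
  shows "f \<in> bmeas \<rho>"
proof -
  obtain B where "\<forall>y. \<bar>f y\<bar> \<le> B" using bounded[OF assms(1)] unfolding bounded_iff by auto
  then have "f \<in> bmeas borel" using measurable[OF assms(1)] by (intro bmeasI) auto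
  then show ?thesis using bmeas_cong_sets[OF assms(2)] by simp
qed

text \<open>
  Since \<open>\<Gamma>\<close> of the constant \<open>1\<close> with itself vanishes, the nonnegative quantity \<open>\<Gamma>\<close> of \<open>f + t\<close> with itself is
  affine in \<open>t\<close>, hence constant in \<open>t\<close>.
\<close>
lemma \<Gamma>_const:
  assumes "f \<in> A"
  shows "\<Gamma> f (\<lambda>_. 1) y = 0"
proof -
  define a where "a = \<Gamma> f f y"
  define b where "b = \<Gamma> f (\<lambda>_. 1) y"
  have quad: "0 \<le> a + 2 * t * b" for t
  proof -
    define k where "k = (\<lambda>y::'y. t * (1::real))"
    have k: "k \<in> A" unfolding k_def by (rule const)
    have fk: "(\<lambda>y. f y + k y) \<in> A" by (rule add[OF assms k])
    have k_left: "\<Gamma> k g y = t * \<Gamma> (\<lambda>_. 1) g y" if "g \<in> A" for g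
      unfolding k_def using \<Gamma>_scale[OF const[of 1] that, of t] by (simp add: fun_eq_iff)
    have "\<Gamma> (\<lambda>y. f y + k y) (\<lambda>y. f y + k y) y = \<Gamma> f (\<lambda>y. f y + k y) y + \<Gamma> k (\<lambda>y. f y + k y) y"
      by (simp add: \<Gamma>_add[OF assms k fk])
    also have "\<dots> = \<Gamma> (\<lambda>y. f y + k y) f y + \<Gamma> (\<lambda>y. f y + k y) k y"
      by (simp add: \<Gamma>_sym[OF assms fk] \<Gamma>_sym[OF k fk])
    also have "\<dots> = \<Gamma> f f y + \<Gamma> k f y + (\<Gamma> f k y + \<Gamma> k k y)"
      by (simp add: \<Gamma>_add[OF assms k assms] \<Gamma>_add[OF assms k k])
    also have "\<Gamma> f k y = \<Gamma> k f y" by (simp add: \<Gamma>_sym[OF assms k])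
    also have "\<Gamma> k f y = t * b" unfolding k_left[OF assms] b_def by (simp add: \<Gamma>_sym[OF assms const[of 1]])
    also have "\<Gamma> k k y = t * (t * \<Gamma> (\<lambda>_. 1) (\<lambda>_. 1) y)"
      unfolding k_left[OF k] by (simp add: \<Gamma>_sym[OF const[of 1] k] k_left[OF const[of 1]])
    finally have "\<Gamma> (\<lambda>y. f y + k y) (\<lambda>y. f y + k y) y = a + 2 * t * b" by (simp add: \<Gamma>_one a_def)
    then show ?thesis using \<Gamma>_nonneg[OF fk, of y] by simp
  qed
  show ?thesis
  proof (rule ccontr)
    assume "\<not> ?thesis"
    then have "b \<noteq> 0" by (simp add: b_def)
    then show False using quad[of "- (a + 1) / (2 * b)"] by (simp add: field_simps)
  qed
qed

lemma \<Gamma>_affine: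
  assumes f: "f \<in> A"
  shows "(\<lambda>y. c + a * f y) \<in> A"
    and "\<Gamma> (\<lambda>y. c + a * f y) (\<lambda>y. c + a * f y) y = a\<^sup>2 * \<Gamma> f f y"
proof -
  define k where "k = (\<lambda>y::'y. c * (1::real))"
  define h where "h = (\<lambda>y. a * f y)"
  have k: "k \<in> A" unfolding k_def by (rule const)
  have h: "h \<in> A" unfolding h_def by (rule scale[OF f])
  have kh: "(\<lambda>y. k y + h y) \<in> A" by (rule add[OF k h])
  have k_left: "\<Gamma> k g y = 0" if "g \<in> A" for g
    unfolding k_def using \<Gamma>_scale[OF const[of 1] that, of c] \<Gamma>_const[OF that, of y] \<Gamma>_sym[OF that const[of 1]]
    by (simp add: fun_eq_iff)
  have "\<Gamma> (\<lambda>y. k y + h y) (\<lambda>y. k y + h y) y = \<Gamma> k (\<lambda>y. k y + h y) y + \<Gamma> h (\<lambda>y. k y + h y) y"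
    by (simp add: \<Gamma>_add[OF k h kh])
  also have "\<dots> = \<Gamma> (\<lambda>y. k y + h y) h y" by (simp add: k_left[OF kh] \<Gamma>_sym[OF h kh])
  also have "\<dots> = \<Gamma> h h y" by (simp add: \<Gamma>_add[OF k h h] k_left[OF h])
  also have "\<dots> = a * \<Gamma> f h y" unfolding h_def by (simp add: \<Gamma>_scale[OF f scale[OF f]])
  also have "\<Gamma> f h y = a * \<Gamma> f f y" unfolding \<Gamma>_sym[OF f h] unfolding h_def by (simp add: \<Gamma>_scale[OF f f])
  finally have "\<Gamma> (\<lambda>y. k y + h y) (\<lambda>y. k y + h y) y = a\<^sup>2 * \<Gamma> f f y" by (simp add: power2_eq_square)
  then show "\<Gamma> (\<lambda>y. c + a * f y) (\<lambda>y. c + a * f y) y = a\<^sup>2 * \<Gamma> f f y" by (simp add: k_def h_def)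
  show "(\<lambda>y. c + a * f y) \<in> A" using kh by (simp add: k_def h_def)
qed

text \<open>
  Apply the log-Sobolev inequality to \<open>1 + \<epsilon> * h\<close>, with \<open>h\<close> the centred \<open>f\<close>, whose energy is exactly
  \<open>\<epsilon>\<^sup>2\<close> times that of \<open>f\<close>, and let \<open>\<epsilon>\<close> tend to \<open>0\<close>.
\<close>
lemma log_sobolev_imp_poincare:
  assumes p: "prob_space \<rho>" and sets: "sets \<rho> = sets borel" and LS: "log_sobolev_ineq A \<Gamma> \<rho> C"
  shows "poincare_ineq A \<Gamma> \<rho> C"
  unfolding poincare_ineq_def
proof
  interpret prob_space \<rho> by fact
  fix f assume f: "f \<in> A"
  define m where "m = (\<integral>y. f y \<partial>\<rho>)"
  define h where "h = (\<lambda>y. f y - m)"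
  note fb = in_bmeas[OF f sets]
  have "(\<integral>y. (h y)\<^sup>2 \<partial>\<rho>) \<le> C * (\<integral>y. \<Gamma> f f y \<partial>\<rho>)"
  proof (rule variance_le_ent_linearised)
    show "h \<in> bmeas \<rho>" unfolding h_def by (intro bmeas_intros fb)
    show "(\<integral>y. h y \<partial>\<rho>) = 0" using bmeas_integrable[OF fb] by (simp add: h_def m_def prob_space)
    fix \<epsilon> :: real
    have eq: "(\<lambda>y. 1 + \<epsilon> * h y) = (\<lambda>y. (1 - \<epsilon> * m) + \<epsilon> * f y)" by (simp add: h_def algebra_simps)
    have "ent \<rho> (\<lambda>y. ((1 - \<epsilon> * m) + \<epsilon> * f y)\<^sup>2) \<le> 2 * C * (\<integral>y. \<epsilon>\<^sup>2 * \<Gamma> f f y \<partial>\<rho>)"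
      using LS[unfolded log_sobolev_ineq_def, rule_format, OF \<Gamma>_affine(1)[OF f, of "1 - \<epsilon> * m" \<epsilon>]]
      unfolding ext[OF \<Gamma>_affine(2)[OF f, of "1 - \<epsilon> * m" \<epsilon>]] .
    then show "ent \<rho> (\<lambda>y. (1 + \<epsilon> * h y)\<^sup>2) \<le> 2 * \<epsilon>\<^sup>2 * (C * (\<integral>y. \<Gamma> f f y \<partial>\<rho>))"
      unfolding fun_cong[OF eq] by (simp add: mult_ac)
  qed
  then show "variance f \<le> C * (\<integral>y. \<Gamma> f f y \<partial>\<rho>)" by (simp add: h_def m_def)
qed

end

text \<open>
  The common form of the Poincare and the log-Sobolev constant, with \<open>b\<close> the (doubled) energy: each
  single inequality is closed under limits of the constant, so the optimal constant is admissible.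
\<close>
lemma Inf_const_attained:
  assumes "Inf {ennreal C | C. 0 \<le> C \<and> (\<forall>f\<in>A. a f \<le> C * b f)} \<le> ennreal \<kappa>"
    and "0 \<le> \<kappa>" "f \<in> A" "0 \<le> b f"
  shows "a f \<le> \<kappa> * (b f :: real)"
proof -
  have "a f \<le> (\<kappa> + \<epsilon>) * b f" if "0 < \<epsilon>" for \<epsilon>
  proof -
    have "ennreal \<kappa> < ennreal (\<kappa> + \<epsilon>)" using that assms(2) by (simp add: ennreal_less_iff)
    with assms(1) have "Inf {ennreal C | C. 0 \<le> C \<and> (\<forall>f\<in>A. a f \<le> C * b f)} < ennreal (\<kappa> + \<epsilon>)" by simp
    then obtain C where C: "0 \<le> C" "\<forall>f\<in>A. a f \<le> C * b f" "ennreal C < ennreal (\<kappa> + \<epsilon>)"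
      unfolding Inf_less_iff by auto
    have "C \<le> \<kappa> + \<epsilon>" using C(1,3) by (simp add: ennreal_less_iff)
    then have "C * b f \<le> (\<kappa> + \<epsilon>) * b f" using assms(4) by (rule mult_right_mono)
    then show ?thesis using C(2) assms(3) by force
  qed
  note le = this
  show ?thesis
  proof (rule tendsto_lowerbound)
    show "((\<lambda>\<epsilon>. (\<kappa> + \<epsilon>) * b f) \<longlongrightarrow> \<kappa> * b f) (at_right 0)" by (auto intro!: tendsto_eq_intros)
    show "\<forall>\<^sub>F \<epsilon> in at_right 0. a f \<le> (\<kappa> + \<epsilon>) * b f"
      using eventually_at_right_less[of "0::real"] by eventually_elim (rule le)
  qed simp
qed

text \<open>
  The infimum is reached along a sequence of bounds, and countably many null sets can be discarded.
\<close>
lemma AE_le_ess_bound: "AE x in \<mu>. g x \<le> ess_bound \<mu> g"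
proof -
  define S where "S = {c. AE x in \<mu>. g x \<le> c}"
  have "top \<in> S" by (simp add: S_def)
  then obtain c :: "nat \<Rightarrow> ennreal" where c: "range c \<subseteq> S" "Inf S = (INF i. c i)"
    using ennreal_Inf_countable_INF[of S] by blast
  have "AE x in \<mu>. \<forall>i. g x \<le> c i" unfolding AE_all_countable using c(1) by (auto simp: S_def)
  then show ?thesis unfolding ess_bound_def S_def[symmetric] c(2)
    by eventually_elim (auto intro: INF_greatest)
qed

section \<open>Functional inequalities for mixtures\<close>

text \<open>
  The factor \<open>2 * (1 + q)\<close> comes from the component entropies, \<open>7 * K\<close> from recentring and \<open>q * ln K * K\<close> from
  the defect. The surplus of \<open>7 * K\<close> over \<open>6 * K\<close> is \<open>1 + (K - 1)\<close>, where the \<open>1\<close> is covered by \<open>6 * q\<close> and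
  \<open>K - 1 \<le> K * ln K\<close> by the logarithmic factor.
\<close>
lemma ln_power_gap:
  fixes K q :: real
  assumes "1 \<le> K" "1 \<le> q"
  shows "2 * (1 + q) + (7 + q * ln K) * K \<le> 6 * (q + K powr q) * (1 + ln (K powr q))"
proof -
  define L where "L = q * ln K"
  have L: "ln (K powr q) = L" using assms by (simp add: L_def ln_powr)
  have "ln K \<le> L" using assms mult_right_mono[of 1 q "ln K"] by (simp add: L_def)
  moreover have "1 - 1 / K \<le> ln K"
    using ln_le_minus_one[of "1 / K"] assms by (simp add: ln_div)
  ultimately have "K * (1 - 1 / K) \<le> K * L" using assms by (intro mult_left_mono) auto
  then have KL: "K - 1 \<le> K * L" using assms by (simp add: right_diff_distrib)
  have L0: "0 \<le> L" using assms by (simp add: L_def)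
  have Kq: "K \<le> K powr q" using powr_mono[of 1 q K] assms by simp
  have "2 * (1 + q) + (7 + L) * K \<le> 6 * (q + K) * (1 + L)"
  proof -
    have "0 \<le> q * L" "0 \<le> K * L" using assms L0 by simp_all
    then show ?thesis using KL assms by (simp add: algebra_simps)
  qed
  also have "\<dots> \<le> 6 * (q + K powr q) * (1 + L)"
    using Kq L0 by (intro mult_right_mono) auto
  finally show ?thesis unfolding L L_def .
qed

locale gradient_mixture = gradient_form A \<Gamma> + mixture \<mu> P borel
  for A :: "('y::topological_space \<Rightarrow> real) set"
    and \<Gamma> :: "('y \<Rightarrow> real) \<Rightarrow> ('y \<Rightarrow> real) \<Rightarrow> 'y \<Rightarrow> real"
    and \<mu> :: "'x measure" and P :: "'x \<Rightarrow> 'y measure"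
begin

lemma energy_bmeas: "f \<in> A \<Longrightarrow> \<Gamma> f f \<in> bmeas borel"
  by (intro in_bmeas \<Gamma>_closed) auto

lemma energy_nonneg: "f \<in> A \<Longrightarrow> 0 \<le> (\<integral>y. \<Gamma> f f y \<partial>\<rho>)"
  by (intro Bochner_Integration.integral_nonneg \<Gamma>_nonneg)

lemma poincare_mixture:
  assumes p: "1 < p" and K: "K_chi2 p P \<mu> = ennreal K" "0 < K"
    and \<kappa>: "AE x in \<mu>. poincare_ineq A \<Gamma> (P x) \<kappa>"
  shows "poincare_ineq A \<Gamma> (\<mu> \<bind> P) (\<kappa> * K)"
  unfolding poincare_ineq_def
proof
  fix f assume f: "f \<in> A"
  have fb: "f \<in> bmeas borel" by (rule in_bmeas[OF f refl])
  have energy: "(\<lambda>x. \<integral>y. \<Gamma> f f y \<partial>P x) \<in> bmeas \<mu>" by (rule bmeas_kernel_mean[OF energy_bmeas[OF f]])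
  have var: "(\<lambda>x. prob_space.variance (P x) f) \<in> bmeas \<mu>" by (rule bmeas_kernel_variance[OF fb])
  have "prob_space.variance (\<mu> \<bind> P) f \<le> K * (\<integral>x. prob_space.variance (P x) f \<partial>\<mu>)"
    by (rule mixture_variance_le[OF p K fb])
  also have "\<dots> \<le> K * (\<integral>x. \<kappa> * (\<integral>y. \<Gamma> f f y \<partial>P x) \<partial>\<mu>)"
  proof (intro mult_left_mono integral_mono_AE)
    show "AE x in \<mu>. prob_space.variance (P x) f \<le> \<kappa> * (\<integral>y. \<Gamma> f f y \<partial>P x)"
      using \<kappa> by eventually_elim (use f in \<open>simp add: poincare_ineq_def\<close>)
  qed (use K bmeas_integrable[OF var] bmeas_integrable[OF energy] in auto)
  also have "\<dots> = \<kappa> * K * (\<integral>y. \<Gamma> f f y \<partial>(\<mu> \<bind> P))"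
    unfolding mixture_integral[OF energy_bmeas[OF f]] by simp
  finally show "prob_space.variance (\<mu> \<bind> P) f \<le> \<kappa> * K * (\<integral>y. \<Gamma> f f y \<partial>(\<mu> \<bind> P))" .
qed

text \<open>
  Passing from \<open>f\<close> to the centred \<open>h\<close> turns the defect \<open>q * ln K * \<integral> h\<^sup>2\<close> and the price of recentring
  into multiples of a variance, to which the Poincare inequality for the mixture applies.
\<close>
lemma log_sobolev_mixture:
  assumes p: "1 < p" and K: "K_chi2 p P \<mu> = ennreal K" "1 \<le> K"
    and \<kappa>: "AE x in \<mu>. log_sobolev_ineq A \<Gamma> (P x) \<kappa>" "0 \<le> \<kappa>"
  defines "q \<equiv> p / (p - 1)"
  shows "log_sobolev_ineq A \<Gamma> (\<mu> \<bind> P) (3 * \<kappa> * (q + K powr q) * (1 + ln (K powr q)))"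
  unfolding log_sobolev_ineq_def
proof
  interpret M: prob_space "\<mu> \<bind> P" by (rule prob_space_mixture)
  have K0: "0 < K" using K(2) by simp
  have q: "1 \<le> q" using p by (simp add: q_def)
  fix f assume f: "f \<in> A"
  define m where "m = (\<integral>y. f y \<partial>(\<mu> \<bind> P))"
  define h where "h = (\<lambda>y. - m + 1 * f y)"
  have h: "h \<in> A" and \<Gamma>h: "\<Gamma> h h = \<Gamma> f f"
    unfolding h_def using \<Gamma>_affine[OF f, of "- m" 1] by auto
  have hb: "h \<in> bmeas borel" by (rule in_bmeas[OF h refl])
  then have hM: "h \<in> bmeas (\<mu> \<bind> P)" by (simp add: bmeas_mixture)
  have fM: "f \<in> bmeas (\<mu> \<bind> P)" using in_bmeas[OF f refl] by (simp add: bmeas_mixture)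
  have h0: "(\<integral>y. h y \<partial>(\<mu> \<bind> P)) = 0"
    using M.bmeas_integrable[OF fM] by (simp add: h_def m_def M.prob_space)
  define I where "I = (\<integral>y. \<Gamma> f f y \<partial>(\<mu> \<bind> P))"
  have I0: "0 \<le> I" unfolding I_def by (rule energy_nonneg[OF f])
  define E where "E = (\<integral>x. ent (P x) (\<lambda>y. (h y)\<^sup>2) \<partial>\<mu>)"
  have h2b: "(\<lambda>y. (h y)\<^sup>2) \<in> bmeas borel" by (rule bmeas_power[OF hb])
  have EI: "E \<le> 2 * \<kappa> * I"
  proof -
    have energy: "(\<lambda>x. \<integral>y. \<Gamma> h h y \<partial>P x) \<in> bmeas \<mu>" by (rule bmeas_kernel_mean[OF energy_bmeas[OF h]])
    have ent: "(\<lambda>x. ent (P x) (\<lambda>y. (h y)\<^sup>2)) \<in> bmeas \<mu>" by (rule bmeas_kernel_ent[OF h2b]) simp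
    have "E \<le> (\<integral>x. 2 * \<kappa> * (\<integral>y. \<Gamma> h h y \<partial>P x) \<partial>\<mu>)" unfolding E_def
    proof (rule integral_mono_AE)
      show "AE x in \<mu>. ent (P x) (\<lambda>y. (h y)\<^sup>2) \<le> 2 * \<kappa> * (\<integral>y. \<Gamma> h h y \<partial>P x)"
        using \<kappa>(1) by eventually_elim (use h in \<open>simp add: log_sobolev_ineq_def\<close>)
    qed (use bmeas_integrable[OF ent] bmeas_integrable[OF energy] in auto)
    also have "\<dots> = 2 * \<kappa> * I"
      unfolding I_def \<Gamma>h[symmetric] mixture_integral[OF energy_bmeas[OF h]] by simp
    finally show ?thesis .
  qed
  have "AE x in \<mu>. poincare_ineq A \<Gamma> (P x) \<kappa>"
    using \<kappa>(1) AE_space by eventually_elim (simp add: log_sobolev_imp_poincare kernel_prob kernel_sets)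
  then have "poincare_ineq A \<Gamma> (\<mu> \<bind> P) (\<kappa> * K)" by (rule poincare_mixture[OF p K(1) K0])
  then have var: "(\<integral>y. (h y)\<^sup>2 \<partial>(\<mu> \<bind> P)) \<le> \<kappa> * K * I"
    unfolding poincare_ineq_def I_def using f by (auto simp: h_def m_def)
  have "ent (\<mu> \<bind> P) (\<lambda>y. (f y)\<^sup>2) = ent (\<mu> \<bind> P) (\<lambda>y. (m + h y)\<^sup>2)" by (simp add: h_def)
  also have "\<dots> \<le> ent (\<mu> \<bind> P) (\<lambda>y. (h y)\<^sup>2) + 7 * (\<integral>y. (h y)\<^sup>2 \<partial>(\<mu> \<bind> P))"
    by (rule M.ent_shift_le[OF hM h0])
  also have "ent (\<mu> \<bind> P) (\<lambda>y. (h y)\<^sup>2) \<le> (1 + q) * E + q * ln K * (\<integral>y. (h y)\<^sup>2 \<partial>(\<mu> \<bind> P))"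
    unfolding E_def q_def by (rule mixture_ent_le[OF p K(1) K0 h2b]) simp
  finally have "ent (\<mu> \<bind> P) (\<lambda>y. (f y)\<^sup>2) \<le> (1 + q) * E + (7 + q * ln K) * (\<integral>y. (h y)\<^sup>2 \<partial>(\<mu> \<bind> P))"
    by (simp add: algebra_simps)
  also have "\<dots> \<le> (1 + q) * (2 * \<kappa> * I) + (7 + q * ln K) * (\<kappa> * K * I)"
    using q K(2) by (intro add_mono mult_left_mono EI var) auto
  also have "\<dots> = (2 * (1 + q) + (7 + q * ln K) * K) * (\<kappa> * I)" by (simp add: algebra_simps)
  also have "\<dots> \<le> 6 * (q + K powr q) * (1 + ln (K powr q)) * (\<kappa> * I)"
    using I0 \<kappa>(2) by (intro mult_right_mono ln_power_gap K(2) q) auto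
  finally show "ent (\<mu> \<bind> P) (\<lambda>y. (f y)\<^sup>2)
      \<le> 2 * (3 * \<kappa> * (q + K powr q) * (1 + ln (K powr q))) * (\<integral>y. \<Gamma> f f y \<partial>(\<mu> \<bind> P))"
    unfolding I_def by (simp add: algebra_simps)
qed

lemma K_P_AE:
  assumes "K_P A \<Gamma> P \<mu> = ennreal \<kappa>" "0 \<le> \<kappa>"
  shows "AE x in \<mu>. poincare_ineq A \<Gamma> (P x) \<kappa>"
  using AE_le_ess_bound[where \<mu>=\<mu> and g="\<lambda>x. poincare_const A \<Gamma> (P x)"]
proof eventually_elim
  case (elim x)
  then have "poincare_const A \<Gamma> (P x) \<le> ennreal \<kappa>" using assms(1) by (simp add: K_P_def)
  then have "Inf {ennreal C | C. 0 \<le> C \<and> (\<forall>f\<in>A. prob_space.variance (P x) f \<le> C * (\<integral>y. \<Gamma> f f y \<partial>P x))} \<le> ennreal \<kappa>"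
    by (simp only: poincare_const_def poincare_ineq_def)
  from Inf_const_attained[OF this assms(2)] show ?case
    unfolding poincare_ineq_def using energy_nonneg by blast
qed

lemma K_LS_AE:
  assumes "K_LS A \<Gamma> P \<mu> = ennreal \<kappa>" "0 \<le> \<kappa>"
  shows "AE x in \<mu>. log_sobolev_ineq A \<Gamma> (P x) \<kappa>"
  using AE_le_ess_bound[where \<mu>=\<mu> and g="\<lambda>x. log_sobolev_const A \<Gamma> (P x)"]
proof eventually_elim
  case (elim x)
  have alt: "log_sobolev_ineq A \<Gamma> (P x) C
      \<longleftrightarrow> (\<forall>f\<in>A. ent (P x) (\<lambda>y. (f y)\<^sup>2) \<le> C * (2 * (\<integral>y. \<Gamma> f f y \<partial>P x)))" for C
    by (simp add: log_sobolev_ineq_def mult_ac)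
  have "log_sobolev_const A \<Gamma> (P x) \<le> ennreal \<kappa>" using elim assms(1) by (simp add: K_LS_def)
  then have "Inf {ennreal C | C. 0 \<le> C \<and>
      (\<forall>f\<in>A. ent (P x) (\<lambda>y. (f y)\<^sup>2) \<le> C * (2 * (\<integral>y. \<Gamma> f f y \<partial>P x)))} \<le> ennreal \<kappa>"
    by (simp only: log_sobolev_const_def alt)
  from Inf_const_attained[OF this assms(2)] show ?case
    unfolding alt using energy_nonneg by simp
qed

end

theorem theorem1:
  fixes A :: "('y::polish_space \<Rightarrow> real) set"
    and \<Gamma> :: "('y \<Rightarrow> real) \<Rightarrow> ('y \<Rightarrow> real) \<Rightarrow> 'y \<Rightarrow> real"
    and P :: "'x::polish_space \<Rightarrow> 'y measure"
    and \<mu> :: "'x measure"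
  assumes "gradient_form A \<Gamma>"
    and "P \<in> borel \<rightarrow>\<^sub>M prob_algebra borel"
    and "prob_space \<mu>" and "sets \<mu> = sets borel"
  shows
    "(\<forall>p>1. K_P A \<Gamma> P \<mu> < \<infinity> \<and> K_chi2 p P \<mu> < \<infinity> \<longrightarrow>
        (let q = p / (p - 1); K = ennpowr (K_chi2 p P \<mu>) q in
          (\<exists>C. poincare_ineq A \<Gamma> (\<mu> \<bind> P) C) \<and>
          poincare_const A \<Gamma> (\<mu> \<bind> P) \<le> K_P A \<Gamma> P \<mu> * (ennreal q + K)))
   \<and> (\<forall>p>1. K_LS A \<Gamma> P \<mu> < \<infinity> \<and> K_chi2 p P \<mu> < \<infinity> \<longrightarrow>
        (let q = p / (p - 1); K = ennpowr (K_chi2 p P \<mu>) q in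
          (\<exists>C. log_sobolev_ineq A \<Gamma> (\<mu> \<bind> P) C) \<and>
          log_sobolev_const A \<Gamma> (\<mu> \<bind> P)
            \<le> 3 * K_LS A \<Gamma> P \<mu> * (ennreal q + K) * (1 + ennreal (ln (enn2real K)))))"
proof -
  have "P \<in> \<mu> \<rightarrow>\<^sub>M prob_algebra borel"
    using assms(2) measurable_cong_sets[OF assms(4) refl] by blast
  then interpret gradient_mixture A \<Gamma> \<mu> P
    using assms(1,3) by (simp add: gradient_mixture_def mixture_def mixture_axioms_def)
  have finite_real: "\<exists>a. c = ennreal a \<and> 0 \<le> a" if "c < \<infinity>" for c :: ennreal
    using that by (cases c) auto
  have K_real: "\<exists>K. K_chi2 p P \<mu> = ennreal K \<and> 1 \<le> K" if p: "1 < p" and fin: "K_chi2 p P \<mu> < \<infinity>" for p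
  proof -
    obtain K where K: "K_chi2 p P \<mu> = ennreal K" "0 \<le> K" using finite_real[OF fin] by blast
    moreover have "1 \<le> ennreal K" unfolding K(1)[symmetric] using assms(3) p by (intro one_le_K_chi2) auto
    ultimately show ?thesis by auto
  qed
  show ?thesis
  proof (intro conjI allI impI; elim conjE)
    fix p :: real assume p: "1 < p" and fin: "K_P A \<Gamma> P \<mu> < \<infinity>" "K_chi2 p P \<mu> < \<infinity>"
    define q where "q = p / (p - 1)"
    have q: "1 \<le> q" using p by (simp add: q_def)
    obtain \<kappa> where \<kappa>: "K_P A \<Gamma> P \<mu> = ennreal \<kappa>" "0 \<le> \<kappa>" using finite_real[OF fin(1)] by blast
    obtain K where K: "K_chi2 p P \<mu> = ennreal K" "1 \<le> K" using K_real[OF p fin(2)] by blast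
    have P: "poincare_ineq A \<Gamma> (\<mu> \<bind> P) (\<kappa> * K)"
      using K by (intro poincare_mixture[OF p K(1)] K_P_AE \<kappa>) auto
    have "K \<le> K powr q" using powr_mono[of 1 q K] q K(2) by simp
    then have Kq: "K \<le> q + K powr q" using q by simp
    have "poincare_const A \<Gamma> (\<mu> \<bind> P) \<le> ennreal (\<kappa> * K)"
      unfolding poincare_const_def using P \<kappa>(2) K(2) by (intro Inf_lower) auto
    also have "\<dots> \<le> ennreal (\<kappa> * (q + K powr q))"
      using Kq \<kappa>(2) by (intro ennreal_leI mult_left_mono)
    also have "\<dots> = K_P A \<Gamma> P \<mu> * (ennreal q + ennpowr (K_chi2 p P \<mu>) q)"
      using \<kappa> K q by (simp add: ennpowr_def ennreal_mult ennreal_plus)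
    finally show "let q = p / (p - 1); K = ennpowr (K_chi2 p P \<mu>) q in
          (\<exists>C. poincare_ineq A \<Gamma> (\<mu> \<bind> P) C) \<and>
          poincare_const A \<Gamma> (\<mu> \<bind> P) \<le> K_P A \<Gamma> P \<mu> * (ennreal q + K)"
      using P unfolding Let_def q_def[symmetric] by blast
  next
    fix p :: real assume p: "1 < p" and fin: "K_LS A \<Gamma> P \<mu> < \<infinity>" "K_chi2 p P \<mu> < \<infinity>"
    define q where "q = p / (p - 1)"
    have q: "1 \<le> q" using p by (simp add: q_def)
    obtain \<kappa> where \<kappa>: "K_LS A \<Gamma> P \<mu> = ennreal \<kappa>" "0 \<le> \<kappa>" using finite_real[OF fin(1)] by blast
    obtain K where K: "K_chi2 p P \<mu> = ennreal K" "1 \<le> K" using K_real[OF p fin(2)] by blast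
    define C where "C = 3 * \<kappa> * (q + K powr q) * (1 + ln (K powr q))"
    have LS: "log_sobolev_ineq A \<Gamma> (\<mu> \<bind> P) C"
      unfolding C_def q_def by (rule log_sobolev_mixture[OF p K K_LS_AE[OF \<kappa>] \<kappa>(2)])
    have ln0: "0 \<le> ln (K powr q)" using K(2) q by (simp add: ln_powr)
    have "log_sobolev_const A \<Gamma> (\<mu> \<bind> P) \<le> ennreal C"
      unfolding log_sobolev_const_def using LS \<kappa>(2) q ln0 by (intro Inf_lower) (auto simp: C_def)
    also have "\<dots> = 3 * K_LS A \<Gamma> P \<mu> * (ennreal q + ennpowr (K_chi2 p P \<mu>) q)
        * (1 + ennreal (ln (enn2real (ennpowr (K_chi2 p P \<mu>) q))))"
      using \<kappa> K q ln0 by (simp add: C_def ennpowr_def ennreal_mult ennreal_plus)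
    finally show "let q = p / (p - 1); K = ennpowr (K_chi2 p P \<mu>) q in
          (\<exists>C. log_sobolev_ineq A \<Gamma> (\<mu> \<bind> P) C) \<and>
          log_sobolev_const A \<Gamma> (\<mu> \<bind> P)
            \<le> 3 * K_LS A \<Gamma> P \<mu> * (ennreal q + K) * (1 + ennreal (ln (enn2real K)))"
      using LS unfolding Let_def q_def[symmetric] by blast
  qed
qed

end
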